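(* Let $(W,S)$ be a Coxeter system of type $\Lambda$ and let $\alpha$ and $\beta$ be braid equivalent reduced expressions. Then, in the braid graph $\mathcal{B}(\alpha)$, $I(\alpha,\beta)=\overline{\operatorname{sig}}(\alpha,\beta)$.
   Context: A Coxeter system $(W,S)$ consists of a finite set $S$ and the group $W=\langle S\mid (st)^{m(s,t)}=e\rangle$, where $m(s,s)=1$ and $m(s,t)=m(t,s)\in\{2,3,\dots\}\cup\{\infty\}$ for $s\neq t$ ($m(s,t)=\infty$ means no relation). Its Coxeter graph has vertex set $S$ and an edge $\{s,t\}$ whenever $m(s,t)\ge 3$. $(W,S)$ is of type $\Lambda$ if $m(s,t)\le 3$ for all $s,t\in S$ (simply laced) and the Coxeter graph contains no three-cycles (triangle free). A reduced expression for $w\in W$ is a word over $S$ of minimal length representing $w$. A braid move replaces three consecutive letters $sts$ by $tst$, where $m(s,t)=3$. Two reduced expressions are braid equivalent if they are related by a finite sequence of braid moves; $[\alpha]$ denotes the braid class (equivalence class) of $\alpha$. The braid graph $\mathcal{B}(\alpha)$ has vertex set $[\alpha]$, with two vertices adjacent if and only if they are related by a single braid move. A braid shadow for a reduced expression $\alpha$ is a set of positions $\{i-1,i,i+1\}$ such that the letters of $\alpha$ in these positions form $sts$ with $m(s,t)=3$. $\mathcal{S}(\alpha)$ is the set of braid shadows for $\alpha$, and $\mathcal{S}([\alpha])=\bigcup_{\beta\in[\alpha]}\mathcal{S}(\beta)$. The center of a braid shadow $\{i-1,i,i+1\}\in\mathcal{S}([\alpha])$ is the position $i$. The dimension of $\alpha$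 is $\dim(\alpha)=|\mathcal{S}([\alpha])|$, and the braid shadows in $\mathcal{S}([\alpha])$ are numbered $1,\dots,\dim(\alpha)$ from left to right. The signature $\operatorname{sig}(\alpha)$ is the ordered list whose $i$th entry $\operatorname{sig}_i(\alpha)$ is the letter of $\alpha$ in the center of the $i$th braid shadow of $[\alpha]$. For braid equivalent reduced expressions $\alpha,\beta$, define $\overline{\operatorname{sig}}(\alpha,\beta)=\{x\in[\alpha]\mid \operatorname{sig}_i(x)=\operatorname{sig}_i(\alpha)\text{ whenever }\operatorname{sig}_i(\alpha)=\operatorname{sig}_i(\beta)\}$. The interval between two vertices of a connected graph $G$ with path metric $d$ is $I(u,v)=\{w\in V(G)\mid d(u,v)=d(u,w)+d(w,v)\}$. *)

theory Defs
  imports "HOL-Algebra.Group" "HOL-Library.Extended_Nat"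
begin

section \<open>Groups given by generators and relators\<close>

text \<open>The pair \<open>(s, True)\<close> stands for the generator \<open>s\<close> and \<open>(s, False)\<close> for its formal inverse.\<close>

type_synonym 's gword = "('s \<times> bool) list"

inductive pres_eq :: "'s set \<Rightarrow> 's gword set \<Rightarrow> 's gword \<Rightarrow> 's gword \<Rightarrow> bool"
  for S :: "'s set" and R :: "'s gword set" where
  pres_refl: "u \<in> lists (S \<times> UNIV) \<Longrightarrow> pres_eq S R u u"
| pres_sym: "pres_eq S R u v \<Longrightarrow> pres_eq S R v u"
| pres_trans: "pres_eq S R u v \<Longrightarrow> pres_eq S R v w \<Longrightarrow> pres_eq S R u w"
| pres_cancel: "u \<in> lists (S \<times> UNIV) \<Longrightarrow> v \<in> lists (S \<times> UNIV) \<Longrightarrow> s \<in> S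
    \<Longrightarrow> pres_eq S R (u @ [(s, b), (s, \<not> b)] @ v) (u @ v)"
| pres_relator: "u \<in> lists (S \<times> UNIV) \<Longrightarrow> v \<in> lists (S \<times> UNIV) \<Longrightarrow> r \<in> R
    \<Longrightarrow> r \<in> lists (S \<times> UNIV) \<Longrightarrow> pres_eq S R (u @ r @ v) (u @ v)"

definition pres_rel :: "'s set \<Rightarrow> 's gword set \<Rightarrow> 's gword rel" where
  "pres_rel S R = {(u, v). pres_eq S R u v}"

definition presented_group :: "'s set \<Rightarrow> 's gword set \<Rightarrow> 's gword set monoid" where
  "presented_group S R =
    \<lparr> carrier = lists (S \<times> UNIV) // pres_rel S R,
      mult = (\<lambda>X Y. \<Union>u\<in>X. \<Union>v\<in>Y. pres_rel S R `` {u @ v}),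
      one = pres_rel S R `` {[]} \<rparr>"

lemma pres_eq_words:
  "pres_eq S R u v \<Longrightarrow> u \<in> lists (S \<times> UNIV) \<and> v \<in> lists (S \<times> UNIV)"
  by (induction rule: pres_eq.induct) auto

lemma equiv_pres_rel: "equiv (lists (S \<times> UNIV)) (pres_rel S R)"
proof (rule equivI)
  show "pres_rel S R \<subseteq> lists (S \<times> UNIV) \<times> lists (S \<times> UNIV)"
    unfolding pres_rel_def using pres_eq_words by blast
  show "refl_on (lists (S \<times> UNIV)) (pres_rel S R)"
    unfolding refl_on_def pres_rel_def by (blast intro: pres_refl)
  show "sym (pres_rel S R)"
    unfolding sym_def pres_rel_def by (blast intro: pres_sym)
  show "trans (pres_rel S R)"
    unfolding trans_def pres_rel_def by (blast intro: pres_trans)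
qed

lemma pres_eq_context:
  assumes "pres_eq S R u v" "p \<in> lists (S \<times> UNIV)" "q \<in> lists (S \<times> UNIV)"
  shows "pres_eq S R (p @ u @ q) (p @ v @ q)"
  using assms
proof (induction rule: pres_eq.induct)
  case (pres_cancel u v s b)
  then show ?case using pres_eq.pres_cancel[of "p @ u" S "v @ q" s R b] by simp
next
  case (pres_relator u v r)
  then show ?case using pres_eq.pres_relator[of "p @ u" S "v @ q" r R] by simp
next
  case (pres_refl u)
  then show ?case by (intro pres_eq.pres_refl) auto
next
  case (pres_sym u v)
  then show ?case by (blast intro: pres_eq.pres_sym)
next
  case (pres_trans u v w)
  then show ?case by (blast intro: pres_eq.pres_trans)
qed

lemma pres_eq_append:
  assumes "pres_eq S R u u'" "pres_eq S R v v'"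
  shows "pres_eq S R (u @ v) (u' @ v')"
proof -
  have "pres_eq S R (u @ v) (u' @ v)"
    using pres_eq_context[OF assms(1), of "[]" v] pres_eq_words[OF assms(2)] by simp
  moreover have "pres_eq S R (u' @ v) (u' @ v')"
    using pres_eq_context[OF assms(2), of u' "[]"] pres_eq_words[OF assms(1)] by simp
  ultimately show ?thesis by (rule pres_trans)
qed

lemma presented_group_mult:
  assumes "u \<in> lists (S \<times> UNIV)" "v \<in> lists (S \<times> UNIV)"
  shows "pres_rel S R `` {u} \<otimes>\<^bsub>presented_group S R\<^esub> pres_rel S R `` {v}
    = pres_rel S R `` {u @ v}"
proof -
  have eq: "pres_rel S R `` {u' @ v'} = pres_rel S R `` {u @ v}"
    if "u' \<in> pres_rel S R `` {u}" "v' \<in> pres_rel S R `` {v}" for u' v'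
    using that equiv_class_eq[OF equiv_pres_rel, of "u @ v" "u' @ v'" S R]
      pres_eq_append[of S R u u' v v'] by (simp add: pres_rel_def)
  have "u \<in> pres_rel S R `` {u}" "v \<in> pres_rel S R `` {v}"
    using assms by (auto simp: pres_rel_def intro: pres_refl)
  then have "(\<Union>u'\<in>pres_rel S R `` {u}. \<Union>v'\<in>pres_rel S R `` {v}. pres_rel S R `` {u' @ v'})
    = pres_rel S R `` {u @ v}"
    using eq by (intro equalityI UN_least) blast+
  then show ?thesis
    unfolding presented_group_def by simp
qed

lemma pres_eq_inverse:
  "u \<in> lists (S \<times> UNIV) \<Longrightarrow> pres_eq S R (rev (map (apsnd Not) u) @ u) []"
proof (induction u)
  case Nil
  then show ?case by (simp add: pres_refl)
next
  case (Cons x u)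
  obtain s b where x: "x = (s, b)" by force
  have u: "u \<in> lists (S \<times> UNIV)" "s \<in> S" using Cons.prems x by auto
  have "rev (map (apsnd Not) u) \<in> lists (S \<times> UNIV)"
    using u(1) by (auto simp: in_lists_conv_set)
  from pres_cancel[OF this u(1) u(2), of R "\<not> b"]
  have "pres_eq S R (rev (map (apsnd Not) u) @ [(s, \<not> b), (s, b)] @ u)
    (rev (map (apsnd Not) u) @ u)" by simp
  then show ?case using pres_trans[OF _ Cons.IH[OF u(1)]] x by simp
qed

lemma group_presented_group: "group (presented_group S R)"
proof -
  let ?G = "presented_group S R" and ?c = "\<lambda>u. pres_rel S R `` {u}"
  have one: "\<one>\<^bsub>?G\<^esub> = ?c []" by (simp add: presented_group_def)
  have carr: "carrier ?G = ?c ` lists (S \<times> UNIV)"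
    by (auto simp: presented_group_def quotient_def)
  have word: "\<exists>u. u \<in> lists (S \<times> UNIV) \<and> x = ?c u" if "x \<in> carrier ?G" for x
    using that unfolding carr by blast
  have app: "u @ v \<in> lists (S \<times> UNIV)" if "u \<in> lists (S \<times> UNIV)" "v \<in> lists (S \<times> UNIV)" for u v
    using that by (simp only: append_in_lists_conv)
  show ?thesis
  proof (rule groupI)
    fix x y assume "x \<in> carrier ?G" "y \<in> carrier ?G"
    then obtain u v where *: "u \<in> lists (S \<times> UNIV)" "x = ?c u" "v \<in> lists (S \<times> UNIV)" "y = ?c v"
      using word by meson
    show "x \<otimes>\<^bsub>?G\<^esub> y \<in> carrier ?G"
      unfolding carr *(2,4) presented_group_mult[OF *(1,3)] by (intro imageI app *)
    fix z assume "z \<in> carrier ?G"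
    then obtain w where z: "w \<in> lists (S \<times> UNIV)" "z = ?c w" using word by meson
    show "x \<otimes>\<^bsub>?G\<^esub> y \<otimes>\<^bsub>?G\<^esub> z = x \<otimes>\<^bsub>?G\<^esub> (y \<otimes>\<^bsub>?G\<^esub> z)"
      unfolding *(2,4) z(2) presented_group_mult[OF *(1,3)] presented_group_mult[OF *(3) z(1)]
        presented_group_mult[OF app[OF *(1,3)] z(1)] presented_group_mult[OF *(1) app[OF *(3) z(1)]]
      by simp
  next
    show "\<one>\<^bsub>?G\<^esub> \<in> carrier ?G" unfolding one carr by (rule imageI) simp
  next
    fix x assume "x \<in> carrier ?G"
    then obtain u where u: "u \<in> lists (S \<times> UNIV)" "x = ?c u" using word by meson
    show "\<one>\<^bsub>?G\<^esub> \<otimes>\<^bsub>?G\<^esub> x = x"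
      unfolding one u(2) presented_group_mult[OF lists.Nil u(1)] by simp
    let ?v = "rev (map (apsnd Not) u)"
    have v: "?v \<in> lists (S \<times> UNIV)" using u(1) by (auto simp: in_lists_conv_set)
    have "?c (?v @ u) = ?c []"
      using pres_eq_inverse[OF u(1)]
      by (intro equiv_class_eq[OF equiv_pres_rel]) (simp add: pres_rel_def)
    then have "?c ?v \<otimes>\<^bsub>?G\<^esub> x = \<one>\<^bsub>?G\<^esub>"
      unfolding one u(2) presented_group_mult[OF v u(1)] .
    moreover have "?c ?v \<in> carrier ?G" unfolding carr by (rule imageI[OF v])
    ultimately show "\<exists>y\<in>carrier ?G. y \<otimes>\<^bsub>?G\<^esub> x = \<one>\<^bsub>?G\<^esub>" by blast
  qed
qed


section \<open>Coxeter systems\<close>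

definition coxeter_matrix :: "'s set \<Rightarrow> ('s \<Rightarrow> 's \<Rightarrow> enat) \<Rightarrow> bool" where
  "coxeter_matrix S m \<longleftrightarrow> finite S \<and> (\<forall>s\<in>S. m s s = 1) \<and>
    (\<forall>s\<in>S. \<forall>t\<in>S. m s t = m t s) \<and> (\<forall>s\<in>S. \<forall>t\<in>S. s \<noteq> t \<longrightarrow> 2 \<le> m s t)"

definition coxeter_relators :: "'s set \<Rightarrow> ('s \<Rightarrow> 's \<Rightarrow> enat) \<Rightarrow> 's gword set" where
  "coxeter_relators S m =
    {concat (replicate k [(s, True), (t, True)]) | s t k. s \<in> S \<and> t \<in> S \<and> m s t = enat k}"

definition coxeter_group :: "'s set \<Rightarrow> ('s \<Rightarrow> 's \<Rightarrow> enat) \<Rightarrow> 's gword set monoid" where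
  "coxeter_group S m = presented_group S (coxeter_relators S m)"

definition coxeter_gen :: "'s set \<Rightarrow> ('s \<Rightarrow> 's \<Rightarrow> enat) \<Rightarrow> 's \<Rightarrow> 's gword set" where
  "coxeter_gen S m s = pres_rel S (coxeter_relators S m) `` {[(s, True)]}"

definition word_elt :: "'s set \<Rightarrow> ('s \<Rightarrow> 's \<Rightarrow> enat) \<Rightarrow> 's list \<Rightarrow> 's gword set" where
  "word_elt S m \<alpha> =
    foldr (\<lambda>s g. coxeter_gen S m s \<otimes>\<^bsub>coxeter_group S m\<^esub> g) \<alpha> \<one>\<^bsub>coxeter_group S m\<^esub>"

definition reduced :: "'s set \<Rightarrow> ('s \<Rightarrow> 's \<Rightarrow> enat) \<Rightarrow> 's list \<Rightarrow> bool" where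
  "reduced S m \<alpha> \<longleftrightarrow> \<alpha> \<in> lists S \<and>
    (\<forall>\<beta>\<in>lists S. word_elt S m \<beta> = word_elt S m \<alpha> \<longrightarrow> length \<alpha> \<le> length \<beta>)"


section \<open>Simple graphs, path metric and intervals\<close>

text \<open>A graph is a pair of a vertex set and a set of two-element edges.\<close>

type_synonym 'v sgraph = "'v set \<times> 'v set set"

definition has_three_cycle :: "'v sgraph \<Rightarrow> bool" where
  "has_three_cycle G \<longleftrightarrow> (\<exists>a\<in>fst G. \<exists>b\<in>fst G. \<exists>c\<in>fst G. a \<noteq> b \<and> b \<noteq> c \<and> a \<noteq> c \<and>
    {a, b} \<in> snd G \<and> {b, c} \<in> snd G \<and> {a, c} \<in> snd G)"

definition is_walk :: "'v sgraph \<Rightarrow> 'v list \<Rightarrow> bool" where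
  "is_walk G p \<longleftrightarrow> p \<noteq> [] \<and> set p \<subseteq> fst G \<and>
    (\<forall>i. Suc i < length p \<longrightarrow> {p ! i, p ! Suc i} \<in> snd G)"

text \<open>The number of edges of a shortest walk; only meaningful if some walk joins \<open>u\<close> and \<open>v\<close>.\<close>

definition graph_dist :: "'v sgraph \<Rightarrow> 'v \<Rightarrow> 'v \<Rightarrow> nat" where
  "graph_dist G u v =
    (LEAST n. \<exists>p. is_walk G p \<and> hd p = u \<and> last p = v \<and> length p = Suc n)"

definition graph_interval :: "'v sgraph \<Rightarrow> 'v \<Rightarrow> 'v \<Rightarrow> 'v set" where
  "graph_interval G u v =
    {w \<in> fst G. graph_dist G u v = graph_dist G u w + graph_dist G w v}"

definition coxeter_graph :: "'s set \<Rightarrow> ('s \<Rightarrow> 's \<Rightarrow> enat) \<Rightarrow> 's sgraph" where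
  "coxeter_graph S m = (S, {{s, t} | s t. s \<in> S \<and> t \<in> S \<and> 3 \<le> m s t})"

definition type_Lambda :: "'s set \<Rightarrow> ('s \<Rightarrow> 's \<Rightarrow> enat) \<Rightarrow> bool" where
  "type_Lambda S m \<longleftrightarrow> coxeter_matrix S m \<and> (\<forall>s\<in>S. \<forall>t\<in>S. m s t \<le> 3) \<and>
    \<not> has_three_cycle (coxeter_graph S m)"


section \<open>Braid classes and braid graphs\<close>

definition braid_move :: "('s \<Rightarrow> 's \<Rightarrow> enat) \<Rightarrow> 's list \<Rightarrow> 's list \<Rightarrow> bool" where
  "braid_move m \<alpha> \<beta> \<longleftrightarrow>
    (\<exists>u v s t. m s t = 3 \<and> \<alpha> = u @ [s, t, s] @ v \<and> \<beta> = u @ [t, s, t] @ v)"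

definition braid_equivalent :: "('s \<Rightarrow> 's \<Rightarrow> enat) \<Rightarrow> 's list \<Rightarrow> 's list \<Rightarrow> bool" where
  "braid_equivalent m = (braid_move m)\<^sup>*\<^sup>*"

text \<open>Braid moves change neither the length nor the represented group element, so the class of a
  reduced expression consists of reduced expressions. A move on a word over \<open>S\<close> introduces
  no new letters, so the set \<open>S\<close> need not be mentioned.\<close>

definition braid_class :: "('s \<Rightarrow> 's \<Rightarrow> enat) \<Rightarrow> 's list \<Rightarrow> 's list set" where
  "braid_class m \<alpha> = {\<beta>. braid_equivalent m \<alpha> \<beta>}"

definition braid_graph :: "('s \<Rightarrow> 's \<Rightarrow> enat) \<Rightarrow> 's list \<Rightarrow> 's list sgraph" where
  "braid_graph m \<alpha> = (braid_class m \<alpha>,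
    {{\<beta>, \<gamma>} | \<beta> \<gamma>. \<beta> \<in> braid_class m \<alpha> \<and> \<gamma> \<in> braid_class m \<alpha> \<and> braid_move m \<beta> \<gamma>})"


section \<open>Braid shadows and signatures\<close>

text \<open>Positions are numbered from \<open>0\<close>, as is usual for lists.\<close>

definition braid_shadows :: "('s \<Rightarrow> 's \<Rightarrow> enat) \<Rightarrow> 's list \<Rightarrow> nat set set" where
  "braid_shadows m \<alpha> = {{i - 1, i, i + 1} | i. 1 \<le> i \<and> i + 1 < length \<alpha> \<and>
    \<alpha> ! (i - 1) = \<alpha> ! (i + 1) \<and> m (\<alpha> ! (i - 1)) (\<alpha> ! i) = 3}"

definition class_shadows :: "('s \<Rightarrow> 's \<Rightarrow> enat) \<Rightarrow> 's list \<Rightarrow> nat set set" where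
  "class_shadows m \<alpha> = (\<Union>\<beta>\<in>braid_class m \<alpha>. braid_shadows m \<beta>)"

definition center :: "nat set \<Rightarrow> nat" where
  "center X = (THE i. 1 \<le> i \<and> X = {i - 1, i, i + 1})"

definition braid_dim :: "('s \<Rightarrow> 's \<Rightarrow> enat) \<Rightarrow> 's list \<Rightarrow> nat" where
  "braid_dim m \<alpha> = card (class_shadows m \<alpha>)"

text \<open>Numbering the shadows of the class from left to right amounts to sorting their centers.\<close>

definition shadow_centers :: "('s \<Rightarrow> 's \<Rightarrow> enat) \<Rightarrow> 's list \<Rightarrow> nat list" where
  "shadow_centers m \<alpha> = sorted_list_of_set (center ` class_shadows m \<alpha>)"

definition sig :: "('s \<Rightarrow> 's \<Rightarrow> enat) \<Rightarrow> 's list \<Rightarrow> 's list" where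
  "sig m \<alpha> = map (\<lambda>i. \<alpha> ! i) (shadow_centers m \<alpha>)"

definition sig_bar :: "('s \<Rightarrow> 's \<Rightarrow> enat) \<Rightarrow> 's list \<Rightarrow> 's list \<Rightarrow> 's list set" where
  "sig_bar m \<alpha> \<beta> = {x \<in> braid_class m \<alpha>.
    \<forall>i < braid_dim m \<alpha>. sig m \<alpha> ! i = sig m \<beta> ! i \<longrightarrow> sig m x ! i = sig m \<alpha> ! i}"

lemma center_shadow:
  assumes "1 \<le> i"
  shows "center {i - 1, i, i + 1} = i"
  unfolding center_def
proof (rule the_equality)
  show "1 \<le> i \<and> {i - 1, i, i + 1} = {i - 1, i, i + 1}" using assms by blast
next
  fix j assume "1 \<le> j \<and> {i - 1, i, i + 1} = {j - 1, j, j + 1}"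
  then have eq: "Max {i - 1, i, i + 1} = Max {j - 1, j, j + 1}" by (simp only:)
  have "Max {k - 1, k, k + 1} = k + 1" for k :: nat by simp
  from eq[unfolded this] show "j = i" by (rule add_right_imp_eq[symmetric])
qed

lemma braid_equivalent_length: "braid_equivalent m \<alpha> \<beta> \<Longrightarrow> length \<beta> = length \<alpha>"
  unfolding braid_equivalent_def
  by (induction rule: rtranclp_induct) (auto simp: braid_move_def)

lemma inj_on_center: "inj_on center (class_shadows m \<alpha>)"
proof (rule inj_onI)
  fix X Y assume "X \<in> class_shadows m \<alpha>" "Y \<in> class_shadows m \<alpha>" and c: "center X = center Y"
  then obtain i j where "1 \<le> i" and X: "X = {i - 1, i, i + 1}"
    and "1 \<le> j" and Y: "Y = {j - 1, j, j + 1}"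
    unfolding class_shadows_def braid_shadows_def by blast
  have "i = j"
    using c[unfolded X Y] unfolding center_shadow[OF \<open>1 \<le> i\<close>] center_shadow[OF \<open>1 \<le> j\<close>] .
  then show "X = Y" unfolding X Y by (simp only:)
qed

lemma finite_class_shadows: "finite (class_shadows m \<alpha>)"
proof (rule finite_subset)
  show "class_shadows m \<alpha> \<subseteq> Pow {..<length \<alpha>}"
  proof
    fix X assume "X \<in> class_shadows m \<alpha>"
    then obtain \<beta> i where "braid_equivalent m \<alpha> \<beta>" "i + 1 < length \<beta>"
      and X: "X = {i - 1, i, i + 1}"
      unfolding class_shadows_def braid_shadows_def braid_class_def by blast
    then have "i + 1 < length \<alpha>" using braid_equivalent_length[of m \<alpha> \<beta>] by simp
    then show "X \<in> Pow {..<length \<alpha>}" unfolding X by simp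
  qed
qed simp

lemma length_sig: "length (sig m \<alpha>) = braid_dim m \<alpha>"
  by (simp add: sig_def shadow_centers_def braid_dim_def finite_class_shadows card_image
      inj_on_center)

end

theory Submission
  imports Defs
begin

text \<open>The point is that a braid class of a reduced word is governed by very little data. Let the edges be
the pairs of letters with \<open>m s t = 3\<close>. Then the centers of the class are pairwise at distance at least
two, each center \<open>p\<close> carries one fixed edge \<open>e p\<close> whose two ends are the only letters ever seen there,
and the state of two centers \<open>p\<close> and \<open>p + 2\<close> is constrained as follows. Their edges share exactly one
letter, \<open>e p = {s, t}\<close> and \<open>e (p + 2) = {s, u}\<close>; the three letters at \<open>p, p + 1, p + 2\<close> are \<open>s, t, u\<close> in some
order, so the middle one is determined by the outer two, and the only forbidden state is \<open>s\<close> at both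
centers. The predicate \<open>frame\<close> records all of this.

A frame for the whole class comes from one with as many centers as possible. A frame survives
every move at one of its centers (\<open>frame_flip\<close>), and a move anywhere else would let the frame grow
(\<open>frame_extend\<close>). The latter is where reducedness enters, and only in the weak form that no word
of the class has a factor \<open>abab\<close>: this factor represents the same element as \<open>ba\<close>. Absence of triangles
keeps the edge at a center from changing.

Signatures are therefore solutions of a chain of constraints, each of which forbids one pair of
values on neighbouring centers. Such a solution set is isometric in the hypercube: if \<open>x\<close> and \<open>y\<close>
differ and no single change of \<open>x\<close> towards \<open>y\<close> is allowed, then every differing center is blocked by a
neighbouring differing center, which is blocked by its own neighbour further in the same direction,
and so on beyond the end of the word (\<open>flip_towards\<close>). Since a move changes exactly one entry of the
signature, distance in the braid graph is the Hamming distance of signatures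
(\<open>graph_dist_eq_card_sig_diff\<close>). As only two letters occur at each center, a word lies in the interval
exactly if at each center where the end points agree it agrees with them.\<close>

section \<open>Braid moves on words\<close>

text \<open>Positions are integers so that left and right can be treated at once, by a step \<open>d\<close> equal to \<open>1\<close> or \<open>-1\<close>.\<close>

definition letter :: "'s list \<Rightarrow> int \<Rightarrow> 's" (infixl "\<cdot>" 100) where
  "x \<cdot> k = x ! nat k"

locale triangle_free_graph =
  fixes E :: "'s \<Rightarrow> 's \<Rightarrow> bool"
  assumes E_sym: "E a b \<Longrightarrow> E b a"
    and no_triangle: "E a b \<Longrightarrow> E b c \<Longrightarrow> \<not> E a c"
begin

lemma E_irrefl: "\<not> E a a"
  using no_triangle by blast

definition braidable :: "'s list \<Rightarrow> int \<Rightarrow> bool" where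
  "braidable x i \<longleftrightarrow> 0 < i \<and> i + 1 < int (length x) \<and> x \<cdot> (i - 1) = x \<cdot> (i + 1) \<and> E (x \<cdot> i) (x \<cdot> (i + 1))"

definition flip :: "'s list \<Rightarrow> int \<Rightarrow> 's list" where
  "flip x i = x[nat (i - 1) := x \<cdot> i, nat i := x \<cdot> (i + 1), nat (i + 1) := x \<cdot> i]"

definition braid_step :: "'s list \<Rightarrow> 's list \<Rightarrow> bool" where
  "braid_step x y \<longleftrightarrow> (\<exists>i. braidable x i \<and> y = flip x i)"

lemma length_flip [simp]: "length (flip x i) = length x"
  by (simp add: flip_def)

lemma letter_flip:
  assumes "braidable x i"
  shows "flip x i \<cdot> i = x \<cdot> (i + 1)" "flip x i \<cdot> (i + 1) = x \<cdot> i" "flip x i \<cdot> (i - 1) = x \<cdot> i"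
    "\<lbrakk>0 \<le> k; k \<notin> {i - 1, i, i + 1}\<rbrakk> \<Longrightarrow> flip x i \<cdot> k = x \<cdot> k"
  using assms by (auto simp: braidable_def flip_def letter_def nth_list_update nat_eq_iff)

lemma letters_eqI:
  assumes "length x = length y" "\<And>k. 0 \<le> k \<Longrightarrow> k < int (length x) \<Longrightarrow> x \<cdot> k = y \<cdot> k"
  shows "x = y"
proof (rule nth_equalityI)
  fix i assume "i < length x"
  then show "x ! i = y ! i" using assms(2)[of "int i"] by (simp add: letter_def)
qed (rule assms(1))

lemma braidable_flip: "braidable x i \<Longrightarrow> braidable (flip x i) i"
  using letter_flip[of x i] E_sym unfolding braidable_def by simp

lemma flip_flip:
  assumes "braidable x i"
  shows "flip (flip x i) i = x"
proof (rule letters_eqI)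
  fix k assume k: "0 \<le> k" "k < int (length (flip (flip x i) i))"
  show "flip (flip x i) i \<cdot> k = x \<cdot> k"
    using letter_flip[OF assms] letter_flip[OF braidable_flip[OF assms]] k assms
    unfolding braidable_def by (cases "k \<in> {i - 1, i, i + 1}") auto
qed simp

lemma braid_step_sym: "braid_step x y \<Longrightarrow> braid_step y x"
  unfolding braid_step_def using braidable_flip flip_flip by metis

lemma braid_steps_sym: "braid_step\<^sup>*\<^sup>* x y \<Longrightarrow> braid_step\<^sup>*\<^sup>* y x"
  by (induction rule: rtranclp_induct) (auto intro: converse_rtranclp_into_rtranclp braid_step_sym)

lemma braid_steps_length: "braid_step\<^sup>*\<^sup>* x y \<Longrightarrow> length y = length x"
  by (induction rule: rtranclp_induct) (auto simp: braid_step_def)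

section \<open>Frames\<close>

text \<open>For words with a known set \<open>P\<close> of centers and known edges \<open>e\<close>, this describes the neighbourhood of \<open>p\<close> in
direction \<open>d\<close>. Without a center at \<open>p + 2 * d\<close> the adjacent letter is the other end of \<open>e p\<close>. With one,
\<open>s\<close> is the common letter of the two edges, and of the assignments of \<open>s, t, u\<close> that respect the edges at
the two centers all three are admitted.\<close>

definition side_ok :: "int set \<Rightarrow> (int \<Rightarrow> 's set) \<Rightarrow> 's list \<Rightarrow> int \<Rightarrow> int \<Rightarrow> bool" where
  "side_ok P e x p d \<longleftrightarrow>
    (if p + 2 * d \<in> P
     then \<exists>s t u. t \<noteq> u \<and> e p = {s, t} \<and> e (p + 2 * d) = {s, u} \<and>
       (x \<cdot> p, x \<cdot> (p + d), x \<cdot> (p + 2 * d)) \<in> {(t, s, u), (s, t, u), (t, u, s)}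
     else e p = {x \<cdot> p, x \<cdot> (p + d)})"

text \<open>The edges \<open>e\<close> and the set \<open>P\<close> are not read off from \<open>x\<close>: they collect what moves elsewhere in the class have
revealed, and \<open>x\<close> is required to be compatible with it.\<close>

definition frame :: "int set \<Rightarrow> (int \<Rightarrow> 's set) \<Rightarrow> 's list \<Rightarrow> bool" where
  "frame P e x \<longleftrightarrow> (\<forall>p\<in>P. 0 < p \<and> p + 1 < int (length x) \<and> p + 1 \<notin> P \<and>
    (\<exists>a b. E a b \<and> e p = {a, b}) \<and> (\<forall>d\<in>{1, -1}. side_ok P e x p d))"

lemma frameD:
  assumes "frame P e x" "p \<in> P"
  shows "0 < p" "p + 1 < int (length x)" "p + 1 \<notin> P" "p - 1 \<notin> P" "\<exists>a b. E a b \<and> e p = {a, b}"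
    "d \<in> {1, -1} \<Longrightarrow> side_ok P e x p d"
  using assms unfolding frame_def by force+

lemma side_ok_swap:
  assumes "p \<in> P" "p + 2 * d \<in> P" "side_ok P e x p d"
  shows "side_ok P e x (p + 2 * d) (- d)"
proof -
  have eq: "p + 2 * d + 2 * - d = p" "p + 2 * d + - d = p + d" by simp_all
  obtain s t u where "t \<noteq> u" "e p = {s, t}" "e (p + 2 * d) = {s, u}"
    "(x \<cdot> p, x \<cdot> (p + d), x \<cdot> (p + 2 * d)) \<in> {(t, s, u), (s, t, u), (t, u, s)}"
    using assms unfolding side_ok_def by auto
  moreover from this(4) have "(x \<cdot> (p + 2 * d), x \<cdot> (p + d), x \<cdot> p) \<in> {(u, s, t), (s, u, t), (u, t, s)}"
    by fast
  ultimately show ?thesis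
    unfolding side_ok_def eq if_P[OF assms(1)] by metis
qed

lemma frame_pair_edge:
  assumes "frame P e x" "p \<in> P" "e p = {a, b}"
  shows "E a b" "a \<noteq> b"
proof -
  show "E a b" using frameD(5)[OF assms(1,2)] assms(3) E_sym by (auto simp: doubleton_eq_iff)
  then show "a \<noteq> b" using E_irrefl by blast
qed

lemma frame_pair:
  assumes "frame P e x" "p \<in> P"
  obtains b where "e p = {x \<cdot> p, b}" "E (x \<cdot> p) b" "b \<noteq> x \<cdot> p"
proof -
  obtain a b where ab: "E a b" "e p = {a, b}" using frameD(5)[OF assms] by blast
  have "x \<cdot> p \<in> e p"
    using frameD(6)[OF assms, of 1] unfolding side_ok_def by (auto split: if_splits)
  then have "e p = {x \<cdot> p, if x \<cdot> p = a then b else a}" using ab(2) by auto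
  then show ?thesis using that frame_pair_edge[OF assms] by metis
qed

text \<open>A move at \<open>p\<close> needs the other end \<open>b\<close> of \<open>e p\<close> on both sides. If it is missing on side \<open>d\<close>, then \<open>b\<close> is the
letter shared with the next edge and currently sits at the next center: that center has to move first.\<close>

lemma blocked_side:
  assumes "frame P e x" "p \<in> P" "d \<in> {1, -1}" "e p = {x \<cdot> p, b}" "x \<cdot> (p + d) \<noteq> b"
  shows "p + 2 * d \<in> P" "x \<cdot> (p + 2 * d) = b" "e (p + 2 * d) = {b, x \<cdot> (p + d)}"
    "x \<cdot> (p + d) \<notin> e p"
proof -
  have ne: "b \<noteq> x \<cdot> p"
    using frame_pair_edge(2)[OF assms(1,2,4)] by simp
  have ok: "side_ok P e x p d" by (rule frameD(6)[OF assms(1-3)])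
  show P: "p + 2 * d \<in> P"
    using ok assms(4,5) ne unfolding side_ok_def by (auto simp: doubleton_eq_iff split: if_splits)
  obtain s t u where stu: "t \<noteq> u" "e p = {s, t}" "e (p + 2 * d) = {s, u}"
    "(x \<cdot> p, x \<cdot> (p + d), x \<cdot> (p + 2 * d)) \<in> {(t, s, u), (s, t, u), (t, u, s)}"
    using ok P unfolding side_ok_def by auto
  have neq: "s \<noteq> t" "s \<noteq> u"
    using frame_pair_edge(2)[OF assms(1,2) stu(2)] frame_pair_edge(2)[OF assms(1) P stu(3)] by simp_all
  have "x \<cdot> (p + 2 * d) = b \<and> e (p + 2 * d) = {b, x \<cdot> (p + d)} \<and> x \<cdot> (p + d) \<notin> e p"
    using stu(4)
  proof (elim insertE emptyE)
    assume "(x \<cdot> p, x \<cdot> (p + d), x \<cdot> (p + 2 * d)) = (t, s, u)"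
    then show ?thesis using stu(2) neq assms(4,5) by (auto simp: doubleton_eq_iff)
  next
    assume "(x \<cdot> p, x \<cdot> (p + d), x \<cdot> (p + 2 * d)) = (s, t, u)"
    then show ?thesis using stu(2) neq assms(4,5) by (auto simp: doubleton_eq_iff)
  next
    assume "(x \<cdot> p, x \<cdot> (p + d), x \<cdot> (p + 2 * d)) = (t, u, s)"
    then show ?thesis using stu(1-3) neq assms(4) by (auto simp: doubleton_eq_iff)
  qed
  then show "x \<cdot> (p + 2 * d) = b" "e (p + 2 * d) = {b, x \<cdot> (p + d)}" "x \<cdot> (p + d) \<notin> e p"
    by simp_all
qed

text \<open>With \<open>s\<close>, \<open>t\<close>, \<open>u\<close> as in \<open>side_ok\<close>, a move at \<open>p\<close> exchanges the states \<open>(t, s, u)\<close> and \<open>(s, t, u)\<close>, and \<open>(t, u, s)\<close>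
does not admit one. All other sides are untouched since centers are not adjacent.\<close>

lemma frame_flip:
  assumes fr: "frame P e x" and i: "i \<in> P" and br: "braidable x i" and ei: "e i = {x \<cdot> i, x \<cdot> (i + 1)}"
  shows "frame P e (flip x i)"
proof -
  let ?y = "flip x i"
  have far: "?y \<cdot> k = x \<cdot> k" if "0 \<le> k" "k \<notin> {i - 1, i, i + 1}" for k
    using letter_flip(4)[OF br that] .
  have notadj: "p \<notin> {i - 1, i + 1}" if "p \<in> P" for p
    using frameD(3,4)[OF fr i] that by blast
  have sym: "x \<cdot> (i - 1) = x \<cdot> (i + 1)" using br unfolding braidable_def by simp
  have at_i: "side_ok P e ?y i d" if d: "d \<in> {1, -1}" for d
  proof -
    have y: "?y \<cdot> i = x \<cdot> (i + d)" "?y \<cdot> (i + d) = x \<cdot> i"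
      using letter_flip(1-3)[OF br] sym d by (elim insertE emptyE; simp)+
    have e: "e i = {x \<cdot> i, x \<cdot> (i + d)}" using ei sym d by (elim insertE emptyE; simp)
    have ok: "side_ok P e x i d" using frameD(6)[OF fr i d] .
    show ?thesis
    proof (cases "i + 2 * d \<in> P")
      case False
      then show ?thesis using e y unfolding side_ok_def by auto
    next
      case True
      then have yq: "?y \<cdot> (i + 2 * d) = x \<cdot> (i + 2 * d)"
        using frameD(1)[OF fr True] d by (intro far) auto
      obtain s t u where stu: "t \<noteq> u" "e i = {s, t}" "e (i + 2 * d) = {s, u}"
        "(x \<cdot> i, x \<cdot> (i + d), x \<cdot> (i + 2 * d)) \<in> {(t, s, u), (s, t, u), (t, u, s)}"
        using ok True unfolding side_ok_def by auto
      have "s \<noteq> u" using frame_pair_edge(2)[OF fr True stu(3)] .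
      moreover have "{s, t} = {x \<cdot> i, x \<cdot> (i + d)}" using e stu(2) by simp
      ultimately have "(x \<cdot> (i + d), x \<cdot> i, x \<cdot> (i + 2 * d)) \<in> {(t, s, u), (s, t, u), (t, u, s)}"
        using stu(1,4) by (elim insertE emptyE) (auto simp: doubleton_eq_iff)
      then show ?thesis unfolding side_ok_def if_P[OF True] y yq using stu(1-3) by blast
    qed
  qed
  have sides: "side_ok P e ?y p d" if p: "p \<in> P" and d: "d \<in> {1, -1}" for p d
  proof -
    consider "p = i" | "p + 2 * d = i" | "p \<noteq> i" "p + 2 * d \<noteq> i" by blast
    then show ?thesis
    proof cases
      case 1
      then show ?thesis using at_i d by simp
    next
      case 2
      have "side_ok P e ?y i (- d)" using at_i d by auto
      then show ?thesis using side_ok_swap[of i P "- d" e ?y] i p 2 by auto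
    next
      case 3
      have "?y \<cdot> p = x \<cdot> p" "?y \<cdot> (p + d) = x \<cdot> (p + d)"
        using 3 d notadj[OF p] frameD(1)[OF fr p] by (auto intro!: far)
      moreover have "?y \<cdot> (p + 2 * d) = x \<cdot> (p + 2 * d)" if "p + 2 * d \<in> P"
        using 3 notadj[OF that] frameD(1)[OF fr that] by (intro far) auto
      ultimately show ?thesis using frameD(6)[OF fr p d] unfolding side_ok_def by auto
    qed
  qed
  show ?thesis
    unfolding frame_def length_flip
  proof (intro ballI conjI)
    fix p assume p: "p \<in> P"
    show "0 < p" "p + 1 < int (length x)" "p + 1 \<notin> P" "\<exists>a b. E a b \<and> e p = {a, b}"
      by (rule frameD[OF fr p])+
    show "side_ok P e ?y p d" if "d \<in> {1, -1}" for d by (rule sides[OF p that])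
  qed
qed

text \<open>A blocked side can always be cleared without disturbing the letters on the other side of \<open>p\<close>: the
blocking center is first cleared on its own far side, by induction towards the end of the word, and
the letter on its near side is already the one that its move requires.\<close>

lemma unblock_side:
  assumes "frame P e x" "p \<in> P" "d \<in> {1, -1}"
  shows "\<exists>y. braid_step\<^sup>*\<^sup>* x y \<and> frame P e y \<and> e p = {y \<cdot> p, y \<cdot> (p + d)} \<and>
    (\<forall>k. 0 \<le> k \<longrightarrow> d * k \<le> d * p \<longrightarrow> y \<cdot> k = x \<cdot> k)"
  using assms(2)
proof (induction "nat (int (length x) - d * p)" arbitrary: p rule: less_induct)
  case less
  obtain b where b: "e p = {x \<cdot> p, b}" "E (x \<cdot> p) b" "b \<noteq> x \<cdot> p"
    using frame_pair[OF assms(1) less.prems] .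
  show ?case
  proof (cases "x \<cdot> (p + d) = b")
    case True
    then show ?thesis using b assms(1) by blast
  next
    case False
    let ?q = "p + 2 * d"
    note blk = blocked_side[OF assms(1) less.prems assms(3) b(1) False]
    have rng: "0 < p" "p + 1 < int (length x)" "0 < ?q" "?q + 1 < int (length x)"
      using frameD[OF assms(1) less.prems] frameD[OF assms(1) blk(1)] by auto
    have "nat (int (length x) - d * ?q) < nat (int (length x) - d * p)"
      using assms(3) rng by auto
    from less.hyps[OF this blk(1)] obtain y where y: "braid_step\<^sup>*\<^sup>* x y" "frame P e y"
      "e ?q = {y \<cdot> ?q, y \<cdot> (?q + d)}" "\<And>k. 0 \<le> k \<Longrightarrow> d * k \<le> d * ?q \<Longrightarrow> y \<cdot> k = x \<cdot> k" by auto
    have yq: "y \<cdot> ?q = b" "y \<cdot> (p + d) = x \<cdot> (p + d)" "y \<cdot> p = x \<cdot> p"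
      using y(4)[of ?q] y(4)[of "p + d"] y(4)[of p] blk(2) rng assms(3) by auto
    have yqd: "y \<cdot> (?q + d) = x \<cdot> (p + d)"
      using y(3) blk(3) yq False by (auto simp: doubleton_eq_iff)
    have Eq: "E (y \<cdot> ?q) (x \<cdot> (p + d))"
      using frame_pair_edge(1)[OF y(2) blk(1,3)] yq(1) by simp
    have nb: "(?q - 1 = p + d \<and> ?q + 1 = ?q + d) \<or> (?q - 1 = ?q + d \<and> ?q + 1 = p + d)"
      using assms(3) by auto
    then have yn: "y \<cdot> (?q - 1) = x \<cdot> (p + d)" "y \<cdot> (?q + 1) = x \<cdot> (p + d)"
      using yq(2) yqd by metis+
    have br: "braidable y ?q"
      unfolding braidable_def yn using Eq rng braid_steps_length[OF y(1)] by simp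
    have "e ?q = {y \<cdot> ?q, y \<cdot> (?q + 1)}"
      using y(3) unfolding yn yqd .
    then have fr: "frame P e (flip y ?q)" using frame_flip[OF y(2) blk(1) br] by simp
    have agree: "flip y ?q \<cdot> k = x \<cdot> k" if k: "0 \<le> k" "d * k \<le> d * p" for k
    proof -
      have "flip y ?q \<cdot> k = y \<cdot> k"
        using k(2) assms(3) by (intro letter_flip(4)[OF br k(1)]) auto
      also have "\<dots> = x \<cdot> k" using k(2) assms(3) by (intro y(4)[OF k(1)]) auto
      finally show ?thesis .
    qed
    have "flip y ?q \<cdot> (p + d) = b"
      using nb letter_flip(2,3)[OF br] yq(1) by metis
    moreover have "flip y ?q \<cdot> p = x \<cdot> p" using agree[of p] rng by simp
    ultimately have "e p = {flip y ?q \<cdot> p, flip y ?q \<cdot> (p + d)}" using b(1) by simp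
    moreover have "braid_step\<^sup>*\<^sup>* x (flip y ?q)"
    proof (rule rtranclp.rtrancl_into_rtrancl[OF y(1)])
      show "braid_step y (flip y ?q)" unfolding braid_step_def using br by blast
    qed
    ultimately show ?thesis using fr agree by blast
  qed
qed

text \<open>If every center where \<open>x\<close> differs from \<open>y\<close> were blocked, then so would be the center that blocks it, on
the same side, and this chain would leave the word. A move at \<open>q\<close> gives \<open>x\<close> the letter of \<open>y\<close> there, so this
is what makes braid classes isometric in the hypercube.\<close>

lemma flip_towards:
  assumes fx: "frame P e x" and fy: "frame P e y" and p: "p \<in> P" "x \<cdot> p \<noteq> y \<cdot> p"
  shows "\<exists>q\<in>P. x \<cdot> q \<noteq> y \<cdot> q \<and> braidable x q"
proof (rule ccontr)
  assume none: "\<not> ?thesis"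
  define D where "D = {p \<in> P. x \<cdot> p \<noteq> y \<cdot> p}"
  have pair: "e p = {x \<cdot> p, y \<cdot> p}" if "p \<in> D" for p
  proof -
    have p: "p \<in> P" "x \<cdot> p \<noteq> y \<cdot> p" using that unfolding D_def by auto
    obtain b c where "e p = {x \<cdot> p, b}" "e p = {y \<cdot> p, c}"
      using frame_pair[OF fx p(1)] frame_pair[OF fy p(1)] by metis
    then show ?thesis using p(2) by (auto simp: doubleton_eq_iff)
  qed
  define blocked where "blocked p d \<longleftrightarrow> p \<in> D \<and> d \<in> {1, -1} \<and> x \<cdot> (p + d) \<noteq> y \<cdot> p" for p d
  have blk: "\<exists>d. blocked p d" if pD: "p \<in> D" for p
  proof (rule ccontr)
    assume "\<not> ?thesis"
    then have xp: "x \<cdot> (p + 1) = y \<cdot> p" "x \<cdot> (p - 1) = y \<cdot> p"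
      using pD unfolding blocked_def by (auto dest: spec[of _ "-1::int"] spec[of _ "1::int"])
    have "E (x \<cdot> p) (y \<cdot> p)"
      using frame_pair_edge(1)[OF fx _ pair[OF pD]] pD unfolding D_def by simp
    then show False
      using none xp pD pair[OF pD] frameD(1,2)[OF fx, of p] unfolding D_def braidable_def by auto
  qed
  \<comment> \<open>The word \<open>y\<close> has the shared letter at \<open>p\<close>, so not at the next center, where \<open>x\<close> has it. That
    center differs too, and it is not blocked from the side of \<open>p\<close>.\<close>
  have step: "blocked (p + 2 * d) d" if b: "blocked p d" for p d
  proof -
    let ?q = "p + 2 * d"
    have pd: "p \<in> P" "p \<in> D" "d \<in> {1, -1}" "x \<cdot> (p + d) \<noteq> y \<cdot> p" "x \<cdot> p \<noteq> y \<cdot> p"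
      using b unfolding blocked_def D_def by auto
    note bs = blocked_side[OF fx pd(1,3) pair[OF pd(2)] pd(4)]
    have "y \<cdot> ?q \<noteq> y \<cdot> p"
    proof -
      obtain s t u where stu: "e p = {s, t}" "e ?q = {s, u}" "t \<noteq> u"
        "(y \<cdot> p, y \<cdot> (p + d), y \<cdot> ?q) \<in> {(t, s, u), (s, t, u), (t, u, s)}"
        using frameD(6)[OF fy pd(1,3)] bs(1) unfolding side_ok_def by auto
      have "s \<noteq> t" "s \<noteq> u"
        using frame_pair_edge(2)[OF fy pd(1) stu(1)] frame_pair_edge(2)[OF fy bs(1) stu(2)] by simp_all
      then show ?thesis using stu(3,4) by auto
    qed
    then have q: "?q \<in> D" using bs(1,2) unfolding D_def by simp
    then obtain d' where d': "blocked ?q d'" using blk by blast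
    have yq: "y \<cdot> ?q = x \<cdot> (p + d)"
      using pair[OF q] bs(2,3) \<open>y \<cdot> ?q \<noteq> y \<cdot> p\<close> by (auto simp: doubleton_eq_iff)
    have "d' \<noteq> - d"
    proof
      assume "d' = - d"
      moreover have "?q + - d = p + d" by simp
      ultimately show False using d' yq unfolding blocked_def by metis
    qed
    then have "d' = d" using d' pd(3) unfolding blocked_def by auto
    then show ?thesis using d' by simp
  qed
  have no: "\<not> blocked p d" for p d
  proof (induction "nat (int (length x) - d * p)" arbitrary: p rule: less_induct)
    case less
    show ?case
    proof
      assume b: "blocked p d"
      then have "p \<in> P" "d \<in> {1, -1}" unfolding blocked_def D_def by auto
      then have "nat (int (length x) - d * (p + 2 * d)) < nat (int (length x) - d * p)"
        using frameD(1,2)[OF fx, of p] by auto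
      from less[OF this] step[OF b] show False by simp
    qed
  qed
  then show False using blk[of p] p unfolding D_def by auto
qed

section \<open>Extending a frame\<close>

definition abab_free :: "'s list \<Rightarrow> bool" where
  "abab_free x \<longleftrightarrow> (\<forall>k. 0 \<le> k \<longrightarrow> k + 3 < int (length x) \<longrightarrow> x \<cdot> k = x \<cdot> (k + 2) \<longrightarrow>
    x \<cdot> (k + 1) = x \<cdot> (k + 3) \<longrightarrow> \<not> E (x \<cdot> k) (x \<cdot> (k + 1)))"

text \<open>The factor is read in direction \<open>d\<close>, with \<open>i\<close> as the position of its second letter.\<close>

lemma abab_freeD:
  assumes "abab_free x" "d \<in> {1, -1}" "0 \<le> i - d" "i - d < int (length x)"
    "0 \<le> i + 2 * d" "i + 2 * d < int (length x)" "E (x \<cdot> i) (x \<cdot> (i + d))"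
    "x \<cdot> (i - d) = x \<cdot> (i + d)"
  shows "x \<cdot> (i + 2 * d) \<noteq> x \<cdot> i"
proof (cases "d = 1")
  case True
  then show ?thesis
    using assms(1)[unfolded abab_free_def, rule_format, of "i - 1"] assms(3-) E_sym by (auto simp: ac_simps)
next
  case False
  then have "d = -1" using assms(2) by simp
  then show ?thesis
    using assms(1)[unfolded abab_free_def, rule_format, of "i - 2"] assms(3-) E_sym by (auto simp: ac_simps)
qed

text \<open>Suppose first that \<open>i\<close> is a center. If the moved letters were not the recorded edge, both sides of
\<open>i\<close> would be blocked, and the letter next to \<open>i\<close> would form a triangle with that edge. If \<open>i\<close> is not a
center, it cannot be next to one: clearing the far side of that center would create a factor \<open>abab\<close>.
So \<open>i\<close> can be added, and for a center \<open>q\<close> at distance two from \<open>i\<close> the letter between them is the one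
that the edges share.\<close>

lemma frame_extend:
  assumes fr: "frame P e x" and br: "braidable x i"
    and free: "\<And>y. braid_step\<^sup>*\<^sup>* x y \<Longrightarrow> abab_free y"
  shows "(i \<in> P \<and> e i = {x \<cdot> i, x \<cdot> (i + 1)}) \<or>
    (i \<notin> P \<and> frame (insert i P) (e(i := {x \<cdot> i, x \<cdot> (i + 1)})) x)"
proof (cases "i \<in> P")
  case True
  obtain b where b: "e i = {x \<cdot> i, b}" "E (x \<cdot> i) b" "b \<noteq> x \<cdot> i" using frame_pair[OF fr True] .
  have "x \<cdot> (i + 1) = b"
  proof (rule ccontr)
    assume ne: "x \<cdot> (i + 1) \<noteq> b"
    note bs = blocked_side[OF fr True _ b(1) ne, simplified]
    have "E b (x \<cdot> (i + 1))"
      using frame_pair_edge(1)[OF fr bs(1,3)] .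
    then show False using b(2) br no_triangle unfolding braidable_def by blast
  qed
  then show ?thesis using True b by simp
next
  case False
  let ?e = "e(i := {x \<cdot> i, x \<cdot> (i + 1)})"
  have ed: "x \<cdot> (i + d) = x \<cdot> (i + 1)" "x \<cdot> (i - d) = x \<cdot> (i + d)" "E (x \<cdot> i) (x \<cdot> (i + d))"
    "0 \<le> i - d" "i - d < int (length x)"
    if "d \<in> {1, -1}" for d
    using that br unfolding braidable_def by auto
  \<comment> \<open>If both neighbours of \<open>i\<close> were centers, they would carry the same letter, which the frame
    forbids. If only \<open>i + d\<close> is one, its edge is the pair of letters moved at \<open>i\<close>.\<close>
  have adj: "i + d \<notin> P" if d: "d \<in> {1, -1}" for d
  proof
    let ?p = "i + d"
    assume p: "?p \<in> P"
    have md: "- d \<in> {1, -1}" using d by auto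
    have ok: "side_ok P e x ?p (- d)" using frameD(6)[OF fr p md] .
    have eq: "?p + 2 * - d = i - d" "?p + - d = i" by simp_all
    show False
    proof (cases "i - d \<in> P")
      case True
      then obtain s t u where stu: "e ?p = {s, t}" "e (i - d) = {s, u}" "t \<noteq> u"
        "(x \<cdot> ?p, x \<cdot> i, x \<cdot> (i - d)) \<in> {(t, s, u), (s, t, u), (t, u, s)}"
        using ok unfolding side_ok_def eq by auto
      have "s \<noteq> t" "s \<noteq> u"
        using frame_pair_edge(2)[OF fr p stu(1)] frame_pair_edge(2)[OF fr True stu(2)] by simp_all
      then show False using stu(3,4) ed(2)[OF d] by auto
    next
      case notP: False
      then have ep: "e ?p = {x \<cdot> ?p, x \<cdot> i}" using ok unfolding side_ok_def eq by simp
      obtain y where y: "braid_step\<^sup>*\<^sup>* x y" "e ?p = {y \<cdot> ?p, y \<cdot> (?p + d)}"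
        "\<And>k. 0 \<le> k \<Longrightarrow> d * k \<le> d * ?p \<Longrightarrow> y \<cdot> k = x \<cdot> k"
        using unblock_side[OF fr p d] by blast
      have eqs: "y \<cdot> ?p = x \<cdot> ?p" "y \<cdot> i = x \<cdot> i" "y \<cdot> (i - d) = x \<cdot> (i - d)"
        using y(3)[of ?p] y(3)[of i] y(3)[of "i - d"] br d unfolding braidable_def by auto
      have "x \<cdot> i \<noteq> x \<cdot> ?p" using ed(3)[OF d] E_irrefl by metis
      then have "y \<cdot> (?p + d) = x \<cdot> i" using ep y(2) eqs by (auto simp: doubleton_eq_iff)
      moreover have "i + 2 * d = ?p + d" by simp
      ultimately have "y \<cdot> (i + 2 * d) = y \<cdot> i" using eqs by metis
      moreover have "0 \<le> i + 2 * d" "i + 2 * d < int (length x)"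
        using frameD(1,2)[OF fr p] d by auto
      ultimately show False
        using abab_freeD[OF free[OF y(1)] d, of i] ed[OF d] eqs braid_steps_length[OF y(1)] by simp
    qed
  qed
  have at_i: "side_ok (insert i P) ?e x i d" if d: "d \<in> {1, -1}" for d
  proof (cases "i + 2 * d \<in> P")
    case False
    then show ?thesis using ed(1)[OF d] d unfolding side_ok_def by auto
  next
    case True
    let ?q = "i + 2 * d"
    have md: "- d \<in> {1, -1}" using d by auto
    have eq: "?q + 2 * - d = i" "?q + - d = i + d" by simp_all
    have "e ?q = {x \<cdot> ?q, x \<cdot> (i + d)}"
      using frameD(6)[OF fr True md] False unfolding side_ok_def eq by simp
    \<comment> \<open>Otherwise the letters from \<open>i - d\<close> to \<open>i + 2 * d\<close> would read \<open>abab\<close>.\<close>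
    moreover have "x \<cdot> ?q \<noteq> x \<cdot> i"
      using abab_freeD[OF free[OF rtranclp.rtrancl_refl] d, of i] ed[OF d] frameD(1,2)[OF fr True]
      by simp
    moreover have "?q \<noteq> i" using d by auto
    moreover have "?e i = {x \<cdot> (i + d), x \<cdot> i}" using ed(1)[OF d] by auto
    moreover have "?q \<in> insert i P" using True by simp
    ultimately show ?thesis
      unfolding side_ok_def if_P[OF \<open>?q \<in> insert i P\<close>]
      by (intro exI[of _ "x \<cdot> (i + d)"] exI[of _ "x \<cdot> i"] exI[of _ "x \<cdot> ?q"]) auto
  qed
  have sides: "side_ok (insert i P) ?e x p d" if p: "p \<in> insert i P" and d: "d \<in> {1, -1}" for p d
  proof -
    consider "p = i" | "p \<in> P" "p \<noteq> i" "p + 2 * d = i" | "p \<in> P" "p \<noteq> i" "p + 2 * d \<noteq> i"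
      using p by blast
    then show ?thesis
    proof cases
      case 1
      then show ?thesis using at_i d by simp
    next
      case 2
      have "- d \<in> {1, -1}" using d by auto
      from at_i[OF this] have "side_ok (insert i P) ?e x i (- d)" .
      then show ?thesis using side_ok_swap[of i "insert i P" "- d" ?e x] p 2 by auto
    next
      case 3
      have "side_ok (insert i P) ?e x p d = side_ok P e x p d"
        unfolding side_ok_def using 3(2,3) by simp
      then show ?thesis using frameD(6)[OF fr 3(1) d] by simp
    qed
  qed
  have "frame (insert i P) ?e x"
    unfolding frame_def
  proof
    fix p assume p: "p \<in> insert i P"
    have "p + 1 \<notin> insert i P"
    proof (cases "p = i")
      case True
      then show ?thesis using adj[of 1] by simp
    next
      case False
      then have "p \<in> P" "p + 1 \<notin> P" using p frameD(3)[OF fr, of p] by auto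
      moreover have "p + 1 \<noteq> i" using adj[of "-1"] \<open>p \<in> P\<close> by auto
      ultimately show ?thesis by simp
    qed
    moreover have "0 < p \<and> p + 1 < int (length x) \<and> (\<exists>a b. E a b \<and> ?e p = {a, b})"
    proof (cases "p = i")
      case True
      then show ?thesis using br unfolding braidable_def by auto
    next
      case False
      then show ?thesis using p frameD(1,2,5)[OF fr, of p] by auto
    qed
    ultimately show "0 < p \<and> p + 1 < int (length x) \<and> p + 1 \<notin> insert i P \<and>
      (\<exists>a b. E a b \<and> ?e p = {a, b}) \<and> (\<forall>d\<in>{1, -1}. side_ok (insert i P) ?e x p d)"
      using sides[OF p] by blast
  qed
  then show ?thesis using False by blast
qed

section \<open>Moves as replacements of factors\<close>

lemma flip_append:
  "flip (u @ [a, b, c] @ v) (int (length u) + 1) = u @ [b, c, b] @ v"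
proof -
  have n: "nat (int (length u) + 1) = Suc (length u)" "nat (int (length u) + 1 - 1) = length u"
    "nat (int (length u) + 1 + 1) = Suc (Suc (length u))" by simp_all
  show ?thesis
    unfolding flip_def letter_def n by (simp add: nth_append list_update_append)
qed

lemma braidable_append:
  "braidable (u @ [a, b, c] @ v) (int (length u) + 1) \<longleftrightarrow> a = c \<and> E b c"
proof -
  have n: "nat (int (length u) + 1) = Suc (length u)" "nat (int (length u) + 1 - 1) = length u"
    "nat (int (length u) + 1 + 1) = Suc (Suc (length u))" by simp_all
  show ?thesis
    unfolding braidable_def letter_def n by (simp add: nth_append)
qed

lemma split_at:
  assumes "j + k \<le> length x"
  shows "\<exists>u w v. x = u @ w @ v \<and> length u = j \<and> length w = k"
proof (intro exI conjI)
  show "x = take j x @ take k (drop j x) @ drop k (drop j x)"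
    by (simp only: append_take_drop_id)
qed (use assms in auto)

lemma braidableE:
  assumes "braidable x i"
  obtains u a b v where "x = u @ [a, b, a] @ v" "E b a" "i = int (length u) + 1"
proof -
  have i: "0 < i" "i + 1 < int (length x)" using assms unfolding braidable_def by auto
  obtain u w v where uwv: "x = u @ w @ v" "length u = nat (i - 1)" "length w = 3"
  proof -
    have "nat (i - 1) + 3 \<le> length x" using i by linarith
    then show ?thesis using split_at[of "nat (i - 1)" 3 x] that by blast
  qed
  obtain a b c where "w = [a, b, c]" using uwv(3) by (auto simp: length_Suc_conv numeral_3_eq_3)
  moreover have "i = int (length u) + 1" using uwv(2) i by simp
  ultimately show ?thesis using that[of u a b v] assms uwv(1) braidable_append[of u a b c v] by simp
qed

lemma braid_step_iff:
  "braid_step x y \<longleftrightarrow> (\<exists>u v a b. E a b \<and> x = u @ [a, b, a] @ v \<and> y = u @ [b, a, b] @ v)"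
proof
  assume "braid_step x y"
  then obtain i where i: "braidable x i" "y = flip x i" unfolding braid_step_def by blast
  obtain u a b v where "x = u @ [a, b, a] @ v" "E b a" "i = int (length u) + 1"
    using braidableE[OF i(1)] .
  then show "\<exists>u v a b. E a b \<and> x = u @ [a, b, a] @ v \<and> y = u @ [b, a, b] @ v"
    using i(2) flip_append E_sym by metis
next
  assume "\<exists>u v a b. E a b \<and> x = u @ [a, b, a] @ v \<and> y = u @ [b, a, b] @ v"
  then obtain u v a b where *: "E a b" "x = u @ [a, b, a] @ v" "y = u @ [b, a, b] @ v" by blast
  show "braid_step x y"
    unfolding braid_step_def
    using *(3) E_sym[OF *(1)] braidable_append[of u a b a v] flip_append[of u a b a v]
    unfolding *(2) by metis
qed

lemma abab_freeI:
  assumes "\<And>u a b v. x = u @ [a, b, a, b] @ v \<Longrightarrow> \<not> E a b"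
  shows "abab_free x"
  unfolding abab_free_def
proof (intro allI impI notI)
  fix k assume k: "0 \<le> k" "k + 3 < int (length x)" "x \<cdot> k = x \<cdot> (k + 2)"
    "x \<cdot> (k + 1) = x \<cdot> (k + 3)" "E (x \<cdot> k) (x \<cdot> (k + 1))"
  obtain u w v where uwv: "x = u @ w @ v" "length u = nat k" "length w = 4"
  proof -
    have "nat k + 4 \<le> length x" using k(1,2) by linarith
    then show ?thesis using split_at[of "nat k" 4 x] that by blast
  qed
  obtain a b c d where w: "w = [a, b, c, d]"
    using uwv(3) by (auto simp: length_Suc_conv numeral_eq_Suc)
  have n: "nat k = length u" "nat (k + 1) = Suc (length u)" "nat (k + 2) = Suc (Suc (length u))"
    "nat (k + 3) = Suc (Suc (Suc (length u)))"
    using uwv(2) k(1) by simp_all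
  have "a = c" "b = d" "E a b"
    using k(3-5) unfolding letter_def n uwv(1) w by (simp_all add: nth_append)
  then show False using assms uwv(1) w by blast
qed

section \<open>The frame of a braid class\<close>

text \<open>The middle letter between two centers is the element of the union of their edges that occurs at
neither, so letters at centers determine the adjacent ones.\<close>

lemma side_determined:
  assumes fx: "frame P e x" and fy: "frame P e y" and p: "p \<in> P" and d: "d \<in> {1, -1}"
    and same: "\<And>q. q \<in> P \<Longrightarrow> x \<cdot> q = y \<cdot> q"
  shows "x \<cdot> (p + d) = y \<cdot> (p + d)"
proof (cases "p + 2 * d \<in> P")
  case False
  then have "e p = {x \<cdot> p, x \<cdot> (p + d)}" "e p = {y \<cdot> p, y \<cdot> (p + d)}"
    using frameD(6)[OF fx p d] frameD(6)[OF fy p d] unfolding side_ok_def by auto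
  then show ?thesis using same[OF p] by (auto simp: doubleton_eq_iff)
next
  case True
  have mid: "e p \<union> e (p + 2 * d) - {z \<cdot> p, z \<cdot> (p + 2 * d)} = {z \<cdot> (p + d)}"
    if fz: "frame P e z" for z
  proof -
    obtain s t u where stu: "e p = {s, t}" "e (p + 2 * d) = {s, u}" "t \<noteq> u"
      "(z \<cdot> p, z \<cdot> (p + d), z \<cdot> (p + 2 * d)) \<in> {(t, s, u), (s, t, u), (t, u, s)}"
      using frameD(6)[OF fz p d] True unfolding side_ok_def by auto
    have "s \<noteq> t" "s \<noteq> u"
      using frame_pair_edge(2)[OF fz p stu(1)] frame_pair_edge(2)[OF fz True stu(2)] by simp_all
    then show ?thesis unfolding stu(1,2) using stu(3,4) by auto
  qed
  show ?thesis using mid[OF fx] mid[OF fy] same[OF p] same[OF True] by simp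
qed

end

lemma is_walk_Cons2:
  "is_walk G (x # y # p) \<longleftrightarrow> x \<in> fst G \<and> {x, y} \<in> snd G \<and> is_walk G (y # p)"
  unfolding is_walk_def by (auto simp: less_Suc_eq_0_disj all_conj_distrib nth_Cons split: nat.splits)

text \<open>What the combinatorial argument needs to know about reducedness.\<close>

locale abab_free_class = triangle_free_graph E for E :: "'s \<Rightarrow> 's \<Rightarrow> bool" +
  fixes \<alpha> :: "'s list"
  assumes class_abab_free: "braid_step\<^sup>*\<^sup>* \<alpha> x \<Longrightarrow> abab_free x"
begin

definition cls :: "'s list set" where
  "cls = {x. braid_step\<^sup>*\<^sup>* \<alpha> x}"

definition centers :: "int set" where
  "centers = {i. \<exists>x\<in>cls. braidable x i}"

lemma self_in_cls: "\<alpha> \<in> cls"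
  unfolding cls_def by simp

lemma cls_step: "x \<in> cls \<Longrightarrow> braid_step x y \<Longrightarrow> y \<in> cls"
  unfolding cls_def by (auto intro: rtranclp.rtrancl_into_rtrancl)

lemma cls_flip: "x \<in> cls \<Longrightarrow> braidable x i \<Longrightarrow> flip x i \<in> cls"
  using cls_step unfolding braid_step_def by blast

lemma cls_connected: "x \<in> cls \<Longrightarrow> y \<in> cls \<Longrightarrow> braid_step\<^sup>*\<^sup>* x y"
  unfolding cls_def using braid_steps_sym rtranclp_trans by fastforce

lemma cls_length: "x \<in> cls \<Longrightarrow> length x = length \<alpha>"
  unfolding cls_def using braid_steps_length by auto

lemma finite_centers: "finite centers"
proof (rule finite_subset)
  show "centers \<subseteq> {0..int (length \<alpha>)}"
    unfolding centers_def using cls_length by (auto simp: braidable_def)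
qed simp

text \<open>A frame with the largest possible number of centers, for any word of the class, cannot be extended;
hence every move takes place inside it, and it is carried along to all words of the class.\<close>

lemma class_frame:
  "\<exists>e. \<forall>x\<in>cls. frame centers e x"
proof -
  define Q where "Q k \<longleftrightarrow> (\<exists>P e x. x \<in> cls \<and> frame P e x \<and> P \<subseteq> centers \<and> card P = k)" for k
  have "Q 0"
    unfolding Q_def using self_in_cls
    by (intro exI[of _ "{}"] exI[of _ "\<lambda>_. {}"] exI[of _ \<alpha>]) (simp add: frame_def)
  moreover have bound: "\<forall>k. Q k \<longrightarrow> k \<le> card centers"
    unfolding Q_def using card_mono[OF finite_centers] by blast
  ultimately have Qmax: "Q (GREATEST k. Q k)" using GreatestI_nat[of Q 0 "card centers"] by blast
  have le: "k \<le> (GREATEST k. Q k)" if "Q k" for k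
    using Greatest_le_nat[of Q k "card centers"] that bound by blast
  obtain P e x where Pex: "x \<in> cls" "frame P e x" "P \<subseteq> centers" "card P = (GREATEST k. Q k)"
    using Qmax unfolding Q_def by blast
  have fin: "finite P" using finite_subset[OF Pex(3) finite_centers] .
  have move: "i \<in> P \<and> e i = {y \<cdot> i, y \<cdot> (i + 1)}"
    if y: "y \<in> cls" "frame P e y" "braidable y i" for y i
  proof -
    have "i \<in> P \<and> e i = {y \<cdot> i, y \<cdot> (i + 1)} \<or>
      i \<notin> P \<and> frame (insert i P) (e(i := {y \<cdot> i, y \<cdot> (i + 1)})) y"
    proof (rule frame_extend[OF y(2,3)])
      fix z assume "braid_step\<^sup>*\<^sup>* y z"
      then show "abab_free z"
        using y(1) class_abab_free unfolding cls_def by (meson mem_Collect_eq rtranclp_trans)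
    qed
    moreover have "\<not> (i \<notin> P \<and> frame (insert i P) (e(i := {y \<cdot> i, y \<cdot> (i + 1)})) y)"
    proof
      assume new: "i \<notin> P \<and> frame (insert i P) (e(i := {y \<cdot> i, y \<cdot> (i + 1)})) y"
      have "insert i P \<subseteq> centers" using Pex(3) y unfolding centers_def by blast
      moreover have "card (insert i P) = Suc (card P)" using fin new by simp
      ultimately have "Q (Suc (card P))" unfolding Q_def using new y(1) by blast
      then show False using le Pex(4) by fastforce
    qed
    ultimately show ?thesis by blast
  qed
  have fr: "frame P e y" if "y \<in> cls" for y
    using cls_connected[OF Pex(1) that]
  proof (induction rule: rtranclp_induct)
    case base
    show ?case by (rule Pex(2))
  next
    case (step y z)
    have y: "y \<in> cls" using Pex(1) step.hyps(1) unfolding cls_def by auto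
    obtain i where i: "braidable y i" "z = flip y i" using step.hyps(2) unfolding braid_step_def by blast
    show ?case
      using frame_flip[OF step.IH _ i(1)] move[OF y step.IH i(1)] i(2) by simp
  qed
  have "centers \<subseteq> P" unfolding centers_def using move fr by blast
  then have "P = centers" using Pex(3) by blast
  then show ?thesis using fr by blast
qed

text \<open>The edges at the centers; elsewhere the value is arbitrary.\<close>

definition supp :: "int \<Rightarrow> 's set" where
  "supp = (SOME e. \<forall>x\<in>cls. frame centers e x)"

lemma cls_frame: "x \<in> cls \<Longrightarrow> frame centers supp x"
  using someI_ex[OF class_frame] unfolding supp_def[symmetric] by blast

lemma center_apart:
  assumes "i \<in> centers" "p \<in> centers" "p \<noteq> i"
  shows "p \<notin> {i - 1, i, i + 1}"
  using frameD(3,4)[OF cls_frame[OF self_in_cls] assms(1)] assms(2,3) by blast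

lemma cls_two_letters:
  assumes "x \<in> cls" "y \<in> cls" "z \<in> cls" "p \<in> centers" "z \<cdot> p \<noteq> x \<cdot> p" "z \<cdot> p \<noteq> y \<cdot> p"
  shows "x \<cdot> p = y \<cdot> p"
proof -
  obtain a b c where "supp p = {x \<cdot> p, a}" "supp p = {y \<cdot> p, b}" "supp p = {z \<cdot> p, c}"
    using frame_pair[OF cls_frame assms(4)] assms(1-3) by meson
  then show ?thesis using assms(5,6) by (auto simp: doubleton_eq_iff)
qed

section \<open>Distance and intervals\<close>

definition sig_diff :: "'s list \<Rightarrow> 's list \<Rightarrow> int set" where
  "sig_diff x y = {p \<in> centers. x \<cdot> p \<noteq> y \<cdot> p}"

lemma finite_sig_diff: "finite (sig_diff x y)"
  unfolding sig_diff_def using finite_centers by simp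

lemma letter_flip_center:
  assumes "x \<in> cls" "braidable x i" "p \<in> centers" "p \<noteq> i"
  shows "flip x i \<cdot> p = x \<cdot> p"
proof -
  have "i \<in> centers" using assms(1,2) unfolding centers_def by blast
  from center_apart[OF this assms(3,4)] show ?thesis
    using frameD(1)[OF cls_frame[OF assms(1)] assms(3)] by (intro letter_flip(4)[OF assms(2)]) auto
qed

text \<open>A move affects the letter at only one center, because no two centers are adjacent. This bounds
distances from below.\<close>

lemma sig_diff_step:
  assumes "x \<in> cls" "braid_step x y"
  shows "card (sig_diff x z) \<le> Suc (card (sig_diff y z))"
proof -
  obtain i where i: "braidable x i" "y = flip x i" using assms(2) unfolding braid_step_def by blast
  have "sig_diff x z \<subseteq> insert i (sig_diff y z)"
    unfolding sig_diff_def i(2) using letter_flip_center[OF assms(1) i(1)] by auto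
  then have "card (sig_diff x z) \<le> card (insert i (sig_diff y z))"
    by (rule card_mono[rotated]) (simp add: finite_sig_diff)
  also have "\<dots> \<le> Suc (card (sig_diff y z))" by (simp add: card_insert_if finite_sig_diff)
  finally show ?thesis .
qed

lemma sig_diff_decrease:
  assumes "x \<in> cls" "y \<in> cls" "sig_diff x y \<noteq> {}"
  shows "\<exists>z\<in>cls. braid_step x z \<and> card (sig_diff x y) = Suc (card (sig_diff z y))"
proof -
  obtain p where "p \<in> centers" "x \<cdot> p \<noteq> y \<cdot> p" using assms(3) unfolding sig_diff_def by blast
  from flip_towards[OF cls_frame[OF assms(1)] cls_frame[OF assms(2)] this]
  obtain q where q: "q \<in> centers" "x \<cdot> q \<noteq> y \<cdot> q" "braidable x q" by blast
  let ?z = "flip x q"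
  have z: "?z \<in> cls" using cls_flip[OF assms(1) q(3)] .
  have "?z \<cdot> q \<noteq> x \<cdot> q"
    using letter_flip(1)[OF q(3)] q(3) E_irrefl unfolding braidable_def by metis
  then have zq: "?z \<cdot> q = y \<cdot> q"
    using cls_two_letters[OF z assms(2,1) q(1)] q(2) by metis
  have "sig_diff ?z y = sig_diff x y - {q}"
  proof (rule Set.set_eqI)
    fix p
    show "p \<in> sig_diff ?z y \<longleftrightarrow> p \<in> sig_diff x y - {q}"
      unfolding sig_diff_def using letter_flip_center[OF assms(1) q(3), of p] zq by (cases "p = q") auto
  qed
  moreover have "q \<in> sig_diff x y" using q unfolding sig_diff_def by simp
  ultimately have "card (sig_diff x y) = Suc (card (sig_diff ?z y))"
    using card_Suc_Diff1[OF finite_sig_diff] by metis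
  then show ?thesis using z q(3) unfolding braid_step_def by blast
qed

lemma letter_away:
  assumes "x \<in> cls" "0 \<le> k" "\<And>p. p \<in> centers \<Longrightarrow> k \<notin> {p - 1, p, p + 1}"
  shows "x \<cdot> k = \<alpha> \<cdot> k"
  using assms(1)[unfolded cls_def, simplified]
proof (induction rule: rtranclp_induct)
  case (step y z)
  then obtain i where i: "braidable y i" "z = flip y i" unfolding braid_step_def by blast
  have "i \<in> centers" using i step.hyps(1) unfolding centers_def cls_def by blast
  then show ?case using step.IH letter_flip(4)[OF i(1) assms(2) assms(3)] i(2) by simp
qed simp

text \<open>The signature determines the word: letters at and next to centers follow from the frame, all others
are constant on the class.\<close>

lemma sig_diff_empty:
  assumes "x \<in> cls" "y \<in> cls" "sig_diff x y = {}"
  shows "x = y"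
proof (rule letters_eqI)
  show "length x = length y" using assms(1,2) cls_length by simp
  have same: "x \<cdot> p = y \<cdot> p" if "p \<in> centers" for p using assms(3) that unfolding sig_diff_def by blast
  note side = side_determined[OF cls_frame[OF assms(1)] cls_frame[OF assms(2)] _ _ same]
  fix k :: int assume k: "0 \<le> k"
  show "x \<cdot> k = y \<cdot> k"
  proof (cases "\<exists>p\<in>centers. k \<in> {p - 1, p, p + 1}")
    case True
    then obtain p where p: "p \<in> centers" "k \<in> {p - 1, p, p + 1}" by blast
    then show ?thesis using same side[OF p(1), of 1] side[OF p(1), of "-1"] by auto
  next
    case False
    then show ?thesis using letter_away[OF _ k] assms(1,2) by metis
  qed
qed

definition graph :: "'s list sgraph" where
  "graph = (cls, {{x, y} | x y. x \<in> cls \<and> y \<in> cls \<and> braid_step x y})"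

lemma graph_edge: "{x, y} \<in> snd graph \<Longrightarrow> x \<in> cls \<and> y \<in> cls \<and> braid_step x y"
  unfolding graph_def by (auto simp: doubleton_eq_iff intro: braid_step_sym)

lemma walk_length_lower:
  "is_walk graph p \<Longrightarrow> card (sig_diff (hd p) (last p)) < length p"
proof (induction p rule: induct_list012)
  case 1
  then show ?case by (simp add: is_walk_def)
next
  case (2 x)
  then show ?case by (simp add: sig_diff_def)
next
  case (3 x y p)
  have w: "{x, y} \<in> snd graph" "is_walk graph (y # p)" using 3(3) unfolding is_walk_Cons2 by auto
  have "card (sig_diff x (last (y # p))) \<le> Suc (card (sig_diff y (last (y # p))))"
    using sig_diff_step graph_edge[OF w(1)] by blast
  then show ?case using 3(2)[OF w(2)] by simp
qed

lemma walk_exists: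
  assumes "x \<in> cls" "y \<in> cls"
  shows "\<exists>p. is_walk graph p \<and> hd p = x \<and> last p = y \<and> length p = Suc (card (sig_diff x y))"
  using assms(1)
proof (induction "card (sig_diff x y)" arbitrary: x)
  case 0
  then have "x = y" using sig_diff_empty assms(2) finite_sig_diff by simp
  then show ?case
    using 0 by (intro exI[of _ "[x]"]) (simp add: is_walk_def graph_def)
next
  case (Suc n)
  then have "sig_diff x y \<noteq> {}" by auto
  then obtain z where z: "z \<in> cls" "braid_step x z" "card (sig_diff x y) = Suc (card (sig_diff z y))"
    using sig_diff_decrease Suc.prems assms(2) by blast
  then obtain p where p: "is_walk graph p" "hd p = z" "last p = y" "length p = Suc (card (sig_diff z y))"
    using Suc.hyps by auto
  then obtain p' where p': "p = z # p'" by (cases p) auto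
  have "is_walk graph (x # p)"
    using p(1) z Suc.prems unfolding p' is_walk_Cons2 by (auto simp: graph_def)
  then show ?case using p z p' by (intro exI[of _ "x # p"]) auto
qed

lemma graph_dist_eq_card_sig_diff:
  assumes "x \<in> cls" "y \<in> cls"
  shows "graph_dist graph x y = card (sig_diff x y)"
  unfolding graph_dist_def
proof (rule Least_equality)
  show "\<exists>p. is_walk graph p \<and> hd p = x \<and> last p = y \<and> length p = Suc (card (sig_diff x y))"
    by (rule walk_exists[OF assms])
next
  fix n assume "\<exists>p. is_walk graph p \<and> hd p = x \<and> last p = y \<and> length p = Suc n"
  then show "card (sig_diff x y) \<le> n" using walk_length_lower less_Suc_eq_le by metis
qed

text \<open>For the sets \<open>B\<close> and \<open>C\<close> of centers where \<open>z\<close> disagrees with \<open>x\<close> and with \<open>y\<close>, equality in the triangle inequality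
means that \<open>B\<close> and \<open>C\<close> are disjoint: on their intersection \<open>x\<close> and \<open>y\<close> agree, as only two letters occur at a
center, and the rest of their union is the set where \<open>x\<close> and \<open>y\<close> disagree.\<close>

lemma interval_eq_agreeing:
  assumes "x \<in> cls" "y \<in> cls"
  shows "graph_interval graph x y =
    {z \<in> cls. \<forall>p\<in>centers. x \<cdot> p = y \<cdot> p \<longrightarrow> z \<cdot> p = x \<cdot> p}"
proof -
  have "graph_dist graph x y = graph_dist graph x z + graph_dist graph z y \<longleftrightarrow>
    (\<forall>p\<in>centers. x \<cdot> p = y \<cdot> p \<longrightarrow> z \<cdot> p = x \<cdot> p)" if z: "z \<in> cls" for z
  proof -
    let ?B = "sig_diff x z" and ?C = "sig_diff z y"
    have two: "x \<cdot> p = y \<cdot> p" if "p \<in> ?B \<inter> ?C" for p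
      using that cls_two_letters[OF assms z, of p] unfolding sig_diff_def by auto
    have union: "?B \<union> ?C = sig_diff x y \<union> (?B \<inter> ?C)" "sig_diff x y \<inter> (?B \<inter> ?C) = {}"
      using two unfolding sig_diff_def by auto
    have "card ?B + card ?C = card (?B \<union> ?C) + card (?B \<inter> ?C)"
      by (rule card_Un_Int[OF finite_sig_diff finite_sig_diff])
    also have "card (?B \<union> ?C) = card (sig_diff x y) + card (?B \<inter> ?C)"
      unfolding union(1) by (rule card_Un_disjoint) (use union(2) finite_sig_diff in auto)
    finally have "card (sig_diff x y) = card ?B + card ?C \<longleftrightarrow> ?B \<inter> ?C = {}"
      using finite_sig_diff by auto
    also have "\<dots> \<longleftrightarrow> (\<forall>p\<in>centers. x \<cdot> p = y \<cdot> p \<longrightarrow> z \<cdot> p = x \<cdot> p)"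
      using two unfolding sig_diff_def by auto
    finally show ?thesis using assms z by (simp add: graph_dist_eq_card_sig_diff)
  qed
  then show ?thesis unfolding graph_interval_def by (auto simp: graph_def)
qed

end

section \<open>Reduced words of Coxeter groups\<close>

definition positive :: "'s list \<Rightarrow> 's gword" where
  "positive x = map (\<lambda>s. (s, True)) x"

lemma positive_append [simp]: "positive (x @ y) = positive x @ positive y"
  by (simp add: positive_def)

lemma positive_words: "x \<in> lists S \<Longrightarrow> positive x \<in> lists (S \<times> UNIV)"
  by (auto simp: positive_def in_lists_conv_set)

lemma word_elt_eq_class:
  "x \<in> lists S \<Longrightarrow> word_elt S m x = pres_rel S (coxeter_relators S m) `` {positive x}"
proof (induction x)
  case Nil
  then show ?case by (simp add: word_elt_def coxeter_group_def presented_group_def positive_def)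
next
  case (Cons s x)
  then have s: "s \<in> S" and x: "x \<in> lists S" by auto
  have "word_elt S m (s # x) = coxeter_gen S m s \<otimes>\<^bsub>coxeter_group S m\<^esub> word_elt S m x"
    by (simp add: word_elt_def)
  also have "\<dots> = pres_rel S (coxeter_relators S m) `` {[(s, True)] @ positive x}"
    unfolding Cons.IH[OF x] coxeter_gen_def coxeter_group_def
    using s positive_words[OF x] by (intro presented_group_mult) auto
  finally show ?case by (simp add: positive_def)
qed

definition same_elt :: "'s set \<Rightarrow> ('s \<Rightarrow> 's \<Rightarrow> enat) \<Rightarrow> 's list \<Rightarrow> 's list \<Rightarrow> bool" where
  "same_elt S m x y \<longleftrightarrow> pres_eq S (coxeter_relators S m) (positive x) (positive y)"

lemma same_elt_trans: "same_elt S m x y \<Longrightarrow> same_elt S m y z \<Longrightarrow> same_elt S m x z"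
  unfolding same_elt_def by (rule pres_trans)

lemma same_elt_sym: "same_elt S m x y \<Longrightarrow> same_elt S m y x"
  unfolding same_elt_def by (rule pres_sym)

lemma same_elt_context:
  "same_elt S m x y \<Longrightarrow> u \<in> lists S \<Longrightarrow> v \<in> lists S \<Longrightarrow> same_elt S m (u @ x @ v) (u @ y @ v)"
  unfolding same_elt_def positive_append by (intro pres_eq_context positive_words)

lemma word_elt_eq_if_same_elt:
  assumes "same_elt S m x y" "x \<in> lists S" "y \<in> lists S"
  shows "word_elt S m x = word_elt S m y"
  using assms unfolding word_elt_eq_class[OF assms(2)] word_elt_eq_class[OF assms(3)]
  by (intro equiv_class_eq[OF equiv_pres_rel]) (simp add: pres_rel_def same_elt_def)

lemma same_elt_relator:
  assumes "s \<in> S" "t \<in> S" "m s t = enat k" "u \<in> lists S" "v \<in> lists S"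
  shows "same_elt S m (u @ concat (replicate k [s, t]) @ v) (u @ v)"
proof -
  let ?r = "concat (replicate k [(s, True), (t, True)])"
  have pos: "positive (concat (replicate k [s, t])) = ?r"
    by (simp add: positive_def map_concat)
  have "?r \<in> coxeter_relators S m"
    unfolding coxeter_relators_def using assms(1-3) by blast
  moreover have "?r \<in> lists (S \<times> UNIV)"
    using assms(1,2) by (auto simp: in_lists_conv_set)
  ultimately show ?thesis
    unfolding same_elt_def positive_append pos
    using positive_words assms(4,5) by (intro pres_relator)
qed

lemma same_elt_square:
  assumes "coxeter_matrix S m" "s \<in> S" "u \<in> lists S" "v \<in> lists S"
  shows "same_elt S m (u @ [s, s] @ v) (u @ v)"
proof -
  have "m s s = enat 1" using assms(1,2) unfolding coxeter_matrix_def by (simp add: one_enat_def)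
  from same_elt_relator[where m = m, OF assms(2,2) this assms(3,4)] show ?thesis by simp
qed

text \<open>Both words are reached from \<open>stststtst\<close>, by deleting the relator \<open>ststst\<close> or by cancelling squares.\<close>

lemma same_elt_braid:
  assumes "coxeter_matrix S m" "s \<in> S" "t \<in> S" "m s t = 3"
  shows "same_elt S m [s, t, s] [t, s, t]"
proof -
  note sq = same_elt_square[OF assms(1)]
  have m3: "m s t = enat 3" using assms(4) by (simp add: numeral_eq_enat)
  have 1: "same_elt S m [s, t, s, t, s, t, t, s, t] [t, s, t]"
    using same_elt_relator[where m = m and u = "[]" and v = "[t, s, t]", OF assms(2,3) m3] assms(2,3)
    by (simp add: numeral_3_eq_3)
  have 2: "same_elt S m [s, t, s, t, s, t, t, s, t] [s, t, s, t, s, s, t]"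
    using sq[OF assms(3), of "[s, t, s, t, s]" "[s, t]"] assms(2,3) by simp
  have 3: "same_elt S m [s, t, s, t, s, s, t] [s, t, s, t, t]"
    using sq[OF assms(2), of "[s, t, s, t]" "[t]"] assms(2,3) by simp
  have 4: "same_elt S m [s, t, s, t, t] [s, t, s]"
    using sq[OF assms(3), of "[s, t, s]" "[]"] assms(2,3) by simp
  show ?thesis
    by (rule same_elt_trans[OF same_elt_sym[OF same_elt_trans[OF 2 same_elt_trans[OF 3 4]]] 1])
qed

lemma same_elt_abab:
  assumes "coxeter_matrix S m" "s \<in> S" "t \<in> S" "m s t = 3"
  shows "same_elt S m [s, t, s, t] [t, s]"
proof -
  have "same_elt S m [s, t, s, t] [t, s, t, t]"
    using same_elt_context[OF same_elt_braid[OF assms], of "[]" "[t]"] assms(3) by simp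
  moreover have "same_elt S m [t, s, t, t] [t, s]"
    using same_elt_square[OF assms(1,3), of "[t, s]" "[]"] assms(2,3) by simp
  ultimately show ?thesis by (rule same_elt_trans)
qed

lemma reduced_abab:
  assumes "coxeter_matrix S m" "m a b = 3" "reduced S m (u @ [a, b, a, b] @ v)"
  shows False
proof -
  let ?x = "u @ [a, b, a, b] @ v" and ?y = "u @ [b, a] @ v"
  have x: "?x \<in> lists S" using assms(3) unfolding reduced_def by blast
  then have S: "u \<in> lists S" "v \<in> lists S" "a \<in> S" "b \<in> S" and y: "?y \<in> lists S" by auto
  have "word_elt S m ?y = word_elt S m ?x"
    using same_elt_context[OF same_elt_abab[OF assms(1) S(3,4) assms(2)] S(1,2)]
    by (rule word_elt_eq_if_same_elt[OF _ x y, symmetric])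
  then have "length ?x \<le> length ?y" using assms(3) y unfolding reduced_def by blast
  then show False by simp
qed

lemma reduced_braid_move:
  assumes "coxeter_matrix S m" "reduced S m x" "braid_move m x y"
  shows "reduced S m y"
proof -
  obtain u v s t where xy: "m s t = 3" "x = u @ [s, t, s] @ v" "y = u @ [t, s, t] @ v"
    using assms(3) unfolding braid_move_def by blast
  have x: "x \<in> lists S" using assms(2) unfolding reduced_def by blast
  then have S: "u \<in> lists S" "v \<in> lists S" "s \<in> S" "t \<in> S" and y: "y \<in> lists S"
    unfolding xy by auto
  have "word_elt S m y = word_elt S m x"
    using same_elt_context[OF same_elt_braid[OF assms(1) S(3,4) xy(1)] S(1,2)] x y
    unfolding xy(2,3) by (rule word_elt_eq_if_same_elt[symmetric])
  moreover have "length y = length x" unfolding xy by simp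
  ultimately show ?thesis using assms(2) y unfolding reduced_def by simp
qed

definition braid_edge :: "'s set \<Rightarrow> ('s \<Rightarrow> 's \<Rightarrow> enat) \<Rightarrow> 's \<Rightarrow> 's \<Rightarrow> bool" where
  "braid_edge S m a b \<longleftrightarrow> a \<in> S \<and> b \<in> S \<and> m a b = 3"

lemma type_Lambda_triangle_free:
  assumes "type_Lambda S m"
  shows "triangle_free_graph (braid_edge S m)"
proof
  fix a b assume "braid_edge S m a b"
  then show "braid_edge S m b a"
    using assms unfolding braid_edge_def type_Lambda_def coxeter_matrix_def by metis
next
  fix a b c assume ab: "braid_edge S m a b" and bc: "braid_edge S m b c"
  show "\<not> braid_edge S m a c"
  proof
    assume ac: "braid_edge S m a c"
    have ne: "s \<noteq> t" if "braid_edge S m s t" for s t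
      using that assms unfolding braid_edge_def type_Lambda_def coxeter_matrix_def by auto
    have edge: "{s, t} \<in> snd (coxeter_graph S m)" if "braid_edge S m s t" for s t
    proof -
      have "s \<in> S \<and> t \<in> S \<and> 3 \<le> m s t" using that unfolding braid_edge_def by simp
      then show ?thesis unfolding coxeter_graph_def snd_conv by blast
    qed
    have "a \<in> fst (coxeter_graph S m)" "b \<in> fst (coxeter_graph S m)" "c \<in> fst (coxeter_graph S m)"
      using ab bc unfolding braid_edge_def coxeter_graph_def by simp_all
    then have "has_three_cycle (coxeter_graph S m)"
      unfolding has_three_cycle_def
      using ne[OF ab] ne[OF bc] ne[OF ac] edge[OF ab] edge[OF bc] edge[OF ac] by blast
    then show False using assms unfolding type_Lambda_def by blast
  qed
qed

section \<open>Braid classes of reduced words\<close>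

locale reduced_word_of_type_Lambda =
  fixes S :: "'s set" and m :: "'s \<Rightarrow> 's \<Rightarrow> enat" and \<alpha> :: "'s list"
  assumes type_Lambda: "type_Lambda S m" and reduced_word: "reduced S m \<alpha>"
begin

sublocale triangle_free_graph "braid_edge S m"
  by (rule type_Lambda_triangle_free[OF type_Lambda])

lemma coxeter_matrix: "coxeter_matrix S m"
  using type_Lambda unfolding type_Lambda_def by blast

lemma reduced_lists: "reduced S m x \<Longrightarrow> x \<in> lists S"
  unfolding reduced_def by blast

lemma braid_move_iff_step:
  assumes "x \<in> lists S"
  shows "braid_move m x y \<longleftrightarrow> braid_step x y"
  unfolding braid_move_def braid_step_iff braid_edge_def using assms by fastforce

lemma reduced_steps:
  assumes "braid_step\<^sup>*\<^sup>* x y" "reduced S m x"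
  shows "reduced S m y" "braid_equivalent m x y"
proof -
  have "reduced S m y \<and> braid_equivalent m x y"
    using assms(1)
  proof (induction rule: rtranclp_induct)
    case base
    then show ?case using assms(2) unfolding braid_equivalent_def by simp
  next
    case (step y z)
    have "braid_move m y z" using step braid_move_iff_step[OF reduced_lists] by blast
    then show ?case
      using step.IH reduced_braid_move[OF coxeter_matrix] unfolding braid_equivalent_def
      by (meson rtranclp.rtrancl_into_rtrancl)
  qed
  then show "reduced S m y" "braid_equivalent m x y" by simp_all
qed

lemma braid_equivalent_steps:
  assumes "braid_equivalent m x y" "reduced S m x"
  shows "braid_step\<^sup>*\<^sup>* x y"
  using assms(1) unfolding braid_equivalent_def
proof (induction rule: rtranclp_induct)
  case (step y z)
  have "braid_step y z"
    using step.hyps(2) braid_move_iff_step[OF reduced_lists[OF reduced_steps(1)[OF step.IH assms(2)]]]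
    by blast
  with step.IH show ?case by (rule rtranclp.rtrancl_into_rtrancl)
qed simp

sublocale abab_free_class "braid_edge S m" \<alpha>
proof
  fix x assume "braid_step\<^sup>*\<^sup>* \<alpha> x"
  then have "reduced S m x" using reduced_steps(1) reduced_word by blast
  show "abab_free x"
  proof (rule abab_freeI)
    fix u a b v assume "x = u @ [a, b, a, b] @ v"
    then show "\<not> braid_edge S m a b"
      using reduced_abab[OF coxeter_matrix] \<open>reduced S m x\<close> unfolding braid_edge_def by blast
  qed
qed

lemma cls_reduced: "x \<in> cls \<Longrightarrow> reduced S m x"
  unfolding cls_def using reduced_steps(1) reduced_word by blast

lemma braid_class_eq_cls:
  assumes "x \<in> cls"
  shows "braid_class m x = cls"
proof -
  have "braid_equivalent m x y \<longleftrightarrow> y \<in> cls" for y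
  proof
    assume "braid_equivalent m x y"
    then show "y \<in> cls"
      using braid_equivalent_steps[OF _ cls_reduced[OF assms]] assms unfolding cls_def by fastforce
  next
    assume "y \<in> cls"
    then show "braid_equivalent m x y"
      using reduced_steps(2)[OF cls_connected[OF assms] cls_reduced[OF assms]] by blast
  qed
  then show ?thesis unfolding braid_class_def by blast
qed

lemma braid_graph_eq_graph: "braid_graph m \<alpha> = graph"
  unfolding braid_graph_def graph_def braid_class_eq_cls[OF self_in_cls]
proof (rule arg_cong[where f = "Pair cls"])
  have "braid_move m x y \<longleftrightarrow> braid_step x y" if "x \<in> cls" for x y
    by (rule braid_move_iff_step[OF reduced_lists[OF cls_reduced[OF that]]])
  then show "{{x, y} |x y. x \<in> cls \<and> y \<in> cls \<and> braid_move m x y} =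
    {{x, y} |x y. x \<in> cls \<and> y \<in> cls \<and> braid_step x y}" by blast
qed

lemma braidable_iff_shadow:
  assumes "x \<in> lists S"
  shows "braidable x (int i) \<longleftrightarrow>
    1 \<le> i \<and> i + 1 < length x \<and> x ! (i - 1) = x ! (i + 1) \<and> m (x ! (i - 1)) (x ! i) = 3"
proof (cases "1 \<le> i \<and> i + 1 < length x")
  case True
  have n: "nat (int i - 1) = i - 1" "nat (int i + 1) = i + 1" "nat (int i) = i" by auto
  have "x ! (i + 1) \<in> S" "x ! i \<in> S" using True assms by (auto simp: in_lists_conv_set)
  moreover from this have "m (x ! i) (x ! (i + 1)) = m (x ! (i + 1)) (x ! i)"
    using coxeter_matrix unfolding coxeter_matrix_def by blast
  ultimately show ?thesis
    using True unfolding braidable_def letter_def n braid_edge_def by auto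
next
  case False
  then show ?thesis unfolding braidable_def by auto
qed

lemma shadow_centers_eq:
  assumes "x \<in> cls"
  shows "center ` class_shadows m x = {i. int i \<in> centers}"
proof -
  define sh where "sh y i \<longleftrightarrow> 1 \<le> i \<and> i + 1 < length y \<and> y ! (i - 1) = y ! (i + 1) \<and>
    m (y ! (i - 1)) (y ! i) = 3" for y :: "'s list" and i
  have sh: "sh y i \<longleftrightarrow> braidable y (int i)" if "y \<in> cls" for y i
    using braidable_iff_shadow[OF reduced_lists[OF cls_reduced[OF that]]] unfolding sh_def by simp
  have "class_shadows m x = (\<Union>y\<in>cls. {{i - 1, i, i + 1} | i. sh y i})"
    unfolding class_shadows_def braid_class_eq_cls[OF assms] braid_shadows_def sh_def by simp
  also have "\<dots> = (\<lambda>i. {i - 1, i, i + 1}) ` {i. \<exists>y\<in>cls. sh y i}" by blast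
  finally have "center ` class_shadows m x = (\<lambda>i. center {i - 1, i, i + 1}) ` {i. \<exists>y\<in>cls. sh y i}"
    by (simp only: image_image)
  also have "\<dots> = (\<lambda>i. i) ` {i. \<exists>y\<in>cls. sh y i}"
    by (rule image_cong[OF refl]) (use center_shadow in \<open>auto simp: sh_def simp del: One_nat_def\<close>)
  also have "\<dots> = {i. int i \<in> centers}"
    unfolding centers_def using sh by auto
  finally show ?thesis .
qed

lemma sig_bar_eq_agreeing:
  assumes "\<beta> \<in> cls"
  shows "sig_bar m \<alpha> \<beta> = {z \<in> cls. \<forall>p\<in>centers. \<alpha> \<cdot> p = \<beta> \<cdot> p \<longrightarrow> z \<cdot> p = \<alpha> \<cdot> p}"
proof -
  define cs where "cs = shadow_centers m \<alpha>"
  have cs: "shadow_centers m x = cs" if "x \<in> cls" for x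
    unfolding cs_def shadow_centers_def shadow_centers_eq[OF that] shadow_centers_eq[OF self_in_cls] ..
  have set_cs: "set cs = {i. int i \<in> centers}"
    unfolding cs_def shadow_centers_def using finite_class_shadows shadow_centers_eq[OF self_in_cls]
    by (metis finite_imageI set_sorted_list_of_set)
  have dim: "braid_dim m \<alpha> = length cs"
    unfolding length_sig[symmetric] sig_def cs_def by simp
  have "(\<forall>i<braid_dim m \<alpha>. sig m \<alpha> ! i = sig m \<beta> ! i \<longrightarrow> sig m z ! i = sig m \<alpha> ! i) \<longleftrightarrow>
    (\<forall>p\<in>centers. \<alpha> \<cdot> p = \<beta> \<cdot> p \<longrightarrow> z \<cdot> p = \<alpha> \<cdot> p)" if z: "z \<in> cls" for z
  proof -
    have "(\<forall>i<braid_dim m \<alpha>. sig m \<alpha> ! i = sig m \<beta> ! i \<longrightarrow> sig m z ! i = sig m \<alpha> ! i) \<longleftrightarrow>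
      (\<forall>c\<in>set cs. \<alpha> ! c = \<beta> ! c \<longrightarrow> z ! c = \<alpha> ! c)"
      unfolding dim sig_def cs[OF z] cs[OF assms] cs[OF self_in_cls] all_set_conv_all_nth by simp
    also have "\<dots> \<longleftrightarrow> (\<forall>p\<in>int ` set cs. \<alpha> \<cdot> p = \<beta> \<cdot> p \<longrightarrow> z \<cdot> p = \<alpha> \<cdot> p)"
      by (simp add: letter_def)
    also have "int ` set cs = centers"
    proof -
      have "p \<in> int ` {i. int i \<in> centers}" if "p \<in> centers" for p
        using that frameD(1)[OF cls_frame[OF self_in_cls] that]
        by (intro image_eqI[of _ _ "nat p"]) auto
      then show ?thesis unfolding set_cs by auto
    qed
    finally show ?thesis .
  qed
  then show ?thesis unfolding sig_bar_def braid_class_eq_cls[OF self_in_cls] by blast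
qed

end

theorem proposition8p5:
  fixes S :: "'s set" and m :: "'s \<Rightarrow> 's \<Rightarrow> enat" and \<alpha> \<beta> :: "'s list"
  assumes "type_Lambda S m"
    and "reduced S m \<alpha>" and "reduced S m \<beta>"
    and "braid_equivalent m \<alpha> \<beta>"
  shows "graph_interval (braid_graph m \<alpha>) \<alpha> \<beta> = sig_bar m \<alpha> \<beta>"
proof -
  interpret reduced_word_of_type_Lambda S m \<alpha>
    using assms(1,2) by unfold_locales
  have "\<beta> \<in> cls"
    using braid_equivalent_steps[OF assms(4,2)] unfolding cls_def by simp
  then show ?thesis
    unfolding braid_graph_eq_graph using interval_eq_agreeing[OF self_in_cls] sig_bar_eq_agreeing
    by simp
qed

end
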